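(* In type $\widetilde{A}_{m-1}$, the Gelfand–Tsetlin algebra $\mathcal{J}(\underline{u})$ is invariant under commuting moves in $W_m^{\ast}$. That is, if $b,c\in I_m=\mathbb{Z}/m\mathbb{Z}$ are such that $c\neq b,b\pm1$, and $$\underline{u}=s_{a_1}\cdots s_{a_{p-1}}s_bs_cs_{a_{p+2}}\cdots s_{a_n},\qquad \underline{v}=s_{a_1}\cdots s_{a_{p-1}}s_cs_bs_{a_{p+2}}\cdots s_{a_n}$$ in $W_m^{\ast}$, then the algebras $\mathcal{J}(\underline{u})$ and $\mathcal{J}(\underline{v})$ are isomorphic.
   Context: $\mathbb{F}$ is a field of characteristic $\neq 2$. $(W_m,S_m)$ is the Coxeter system of type $\widetilde{A}_{m-1}$, with $S_m=\{s_a:a\in I_m\}$, $I_m=\mathbb{Z}/m\mathbb{Z}$, and Coxeter matrix $\mathbf{m}$. $W_m^{\ast}$ is the free monoid on $S_m$; its elements are called expressions (not necessarily reduced). Geometric realization: $\mathfrak{h}$ is the $\mathbb{F}$-vector space with basis $\{\alpha_a^\vee:a\in I_m\}$, and $\alpha_a\in\mathfrak{h}^{\ast}$ is determined by $\langle\alpha_a,\alpha_b^\vee\rangle=-2\cos(\pi/\mathbf{m}(a,b))$; for $m\ge3$ this is $2$ if $a=b$, $-1$ if $a=b\pm1$, and $0$ otherwise (for $m=2$ it is $-2$ if $a\ne b$). Thus $\sum_{a\in I_m}\alpha_a=0$. $W_m$ acts on the right on $\mathfrak{h}^{\ast}$ by $\gamma\cdot s_a=\gamma-\langle\gamma,\alpha_a^\vee\rangle\alpha_a$,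 and hence on $\mathcal{R}=S(\mathfrak{h}^{\ast})$, graded by $\deg\mathfrak{h}^{\ast}=2$. For an expression $\underline{w}$ of $w$ put $\underline{w}\circ f=f\cdot w^{-1}$. The Demazure operator is $\partial_a(f)=(f-f\cdot s_a)/\alpha_a$. Diagrammatic Soergel category $\mathcal{D}$: objects are expressions in $W_m^\ast$. $\mathrm{Hom}_{\mathcal{D}}(\underline{u},\underline{v})$ is the $\mathbb{F}$-vector space spanned by Soergel graphs with bottom boundary $\underline{u}$ and top boundary $\underline{v}$, that is, finite graphs embedded in $\mathbb{R}\times[0,1]$, with edges colored by $I_m$, whose vertices are univalent (dots, degree $+1$), trivalent of one color (degree $-1$), or $2\mathbf{m}(a,b)$-valent with edges alternating between the two colors $a\neq b$, $\mathbf{m}(a,b)<\infty$ (degree $0$), and whose regions may be decorated by homogeneous elements of $\mathcal{R}$, modulo isotopy and the local relations of the Elias–Williamson diagrammatic Hecke category ("Soergel calculus", Represent. Theory 20 (2016)): decorations in one region multiply and are linear; an $a$-colored edge with a dot at both ends equals the decoration $\alpha_a$; polynomial forcing: a decoration $f$ immediately to the right of an $a$-colored strand equals the decoration $s_a\circ f$ immediately to its left, plus the diagram in which the strand is broken (both ends dotted) with $\partial_a(f)$ placed in the resulting region; the one-color Frobenius relations (a trivalent vertex with one dotted leg is a strand, and the two ways of joining two trivalent vertices agree) and the vanishing of an empty one-colored loop attached to a strand; the two-color relations for each pair with $\mathbf{m}(a,b)<\infty$ (two-color associativity, and the expansion of a dotted $2\mathbf{m}(a,b)$-valent vertex as the Jones–Wenzl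 morphism); the three-color Zamolodchikov relations for finite rank-three parabolic subgroups. In addition, one imposes left annihilation: any graph with a homogeneous decoration $f$ with $\deg f>0$ in the leftmost region is $0$. Composition is vertical concatenation. For $\underline{u}=s_{a_1}\cdots s_{a_n}$ and $1\le k\le n$, $\mathbb{J}_k(\underline{u})\in\mathrm{End}_{\mathcal{D}}(\underline{u})$ is the graph obtained from the identity graph (vertical strands colored $a_1,\dots,a_n$) by replacing the $k$-th strand by a broken strand: an edge from the bottom boundary point ending in a dot and an edge from the top boundary point ending in a dot. $\mathcal{J}(\underline{u})$ is the (unital) subalgebra of $\mathrm{End}_{\mathcal{D}}(\underline{u})$ generated by $\mathbb{J}_1(\underline{u}),\dots,\mathbb{J}_n(\underline{u})$ (the Gelfand–Tsetlin subalgebra). *)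

theory Defs
  imports
    "HOL-Library.Poly_Mapping"
    "HOL-Algebra.QuotRing"
    "HOL-Algebra.Module"
    "Berlekamp_Zassenhaus.Finite_Field"
begin

section \<open>The Coxeter system and its geometric realization\<close>

text \<open>
  The index set $I_m = Z/mZ$ is the type \<^typ>\<open>'m mod_ring\<close> with $m = CARD('m)$; the class
  \<^class>\<open>nontriv\<close> says $m \ge 2$.  An expression is a list of indices.
\<close>

type_synonym 'm expr = "'m mod_ring list"

text \<open>In the Coxeter matrix, the value 0 encodes $\infty$.\<close>

definition cox :: "'m::nontriv mod_ring \<Rightarrow> 'm mod_ring \<Rightarrow> nat" where
  "cox a b =
    (if a = b then 1
     else if CARD('m) = 2 then 0
     else if a = b + 1 \<or> a = b - 1 then 3
     else 2)"

text \<open>The pairing of $\alpha_a$ with $\alpha_b^\vee$, that is $-2\cos(\pi/m(a,b))$.\<close>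

definition cartan :: "'m::nontriv mod_ring \<Rightarrow> 'm mod_ring \<Rightarrow> 'k::field" where
  "cartan a b =
    (if cox a b = 1 then 2
     else if cox a b = 2 then 0
     else if cox a b = 3 then - 1
     else - 2)"

text \<open>
  The symmetric algebra of $h^*$ is the polynomial ring in the basis of $h^*$ dual to the
  basis $(\alpha_b^\vee)_b$ of $h$: a linear form $\gamma$ is the linear polynomial whose
  coefficient at the variable $b$ is $\langle\gamma, \alpha_b^\vee\rangle$.
\<close>

type_synonym ('m, 'k) R = "('m mod_ring \<Rightarrow>\<^sub>0 nat) \<Rightarrow>\<^sub>0 'k"

definition var :: "'m::nontriv mod_ring \<Rightarrow> ('m, 'k::field) R" where
  "var b = Poly_Mapping.single (Poly_Mapping.single b 1) 1"

definition simple_root :: "'m::nontriv mod_ring \<Rightarrow> ('m, 'k::field) R" where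
  "simple_root a = (\<Sum>b\<in>UNIV. Poly_Mapping.single (Poly_Mapping.single b 1) (cartan a b))"

text \<open>Homogeneity for the grading in which linear forms have degree 2.\<close>

definition homogeneous :: "nat \<Rightarrow> ('m::nontriv, 'k::field) R \<Rightarrow> bool" where
  "homogeneous d f \<longleftrightarrow>
    (\<forall>t\<in>Poly_Mapping.keys f. 2 * (\<Sum>b\<in>UNIV. Poly_Mapping.lookup t b) = d)"

definition poly_subst :: "('m::nontriv mod_ring \<Rightarrow> ('m, 'k::field) R) \<Rightarrow> ('m, 'k) R \<Rightarrow> ('m, 'k) R" where
  "poly_subst \<sigma> f =
    (\<Sum>t\<in>Poly_Mapping.keys f.
       Poly_Mapping.single 0 (Poly_Mapping.lookup f t) *
       (\<Prod>b\<in>UNIV. \<sigma> b ^ Poly_Mapping.lookup t b))"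

text \<open>
  $f \cdot s_a$: the algebra endomorphism extending
  $\gamma \mapsto \gamma - \langle\gamma, \alpha_a^\vee\rangle \alpha_a$.
  Since $s_a$ is an involution this is also $s_a \circ f$.
\<close>

definition refl_act :: "'m::nontriv mod_ring \<Rightarrow> ('m, 'k::field) R \<Rightarrow> ('m, 'k) R" where
  "refl_act a = poly_subst (\<lambda>b. if b = a then var b - simple_root a else var b)"

definition demazure :: "'m::nontriv mod_ring \<Rightarrow> ('m, 'k::field) R \<Rightarrow> ('m, 'k) R" where
  "demazure a f = (THE g. simple_root a * g = f - refl_act a f)"


section \<open>Soergel graphs\<close>

text \<open>\<open>alt a b n\<close> is the alternating word $a, b, a, \dots$ of length \<open>n\<close>.\<close>

fun alt :: "'a \<Rightarrow> 'a \<Rightarrow> nat \<Rightarrow> 'a list" where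
  "alt a b 0 = []"
| "alt a b (Suc n) = a # alt b a n"

text \<open>
  A Soergel graph in general position is cut by horizontal lines into layers, each of which
  consists of vertical strands and exactly one of the following pieces: a local minimum or
  maximum of an edge, a dot, a trivalent vertex, a $2m(a,b)$-valent vertex, or a polynomial
  decoration.  A graph is represented by the list of its layers from bottom to top; a layer
  \<open>(l, g, r)\<close> has the vertical strands \<open>l\<close> to the left and \<open>r\<close> to the right of the piece \<open>g\<close>.
  Planar isotopy then becomes a set of local relations (see \<open>local_rel\<close> below).
\<close>

datatype ('m, 'r) piece =
    Cup "'m mod_ring"
  | Cap "'m mod_ring"
  | StartDot "'m mod_ring"
  | EndDot "'m mod_ring"
  | Split "'m mod_ring"
  | Merge "'m mod_ring"
  | Vertex "'m mod_ring" "'m mod_ring"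
  | Box 'r

fun src :: "('m::nontriv, ('m, 'k::field) R) piece \<Rightarrow> 'm expr" where
  "src (Cup a) = []"
| "src (Cap a) = [a, a]"
| "src (StartDot a) = []"
| "src (EndDot a) = [a]"
| "src (Split a) = [a]"
| "src (Merge a) = [a, a]"
| "src (Vertex a b) = alt a b (cox a b)"
| "src (Box f) = []"

fun tgt :: "('m::nontriv, ('m, 'k::field) R) piece \<Rightarrow> 'm expr" where
  "tgt (Cup a) = [a, a]"
| "tgt (Cap a) = []"
| "tgt (StartDot a) = [a]"
| "tgt (EndDot a) = []"
| "tgt (Split a) = [a, a]"
| "tgt (Merge a) = [a]"
| "tgt (Vertex a b) = alt b a (cox a b)"
| "tgt (Box f) = []"

fun admissible :: "('m::nontriv, ('m, 'k::field) R) piece \<Rightarrow> bool" where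
  "admissible (Vertex a b) \<longleftrightarrow> a \<noteq> b \<and> cox a b \<noteq> 0"
| "admissible (Box f) \<longleftrightarrow> (\<exists>d. homogeneous d f)"
| "admissible _ \<longleftrightarrow> True"

type_synonym ('m, 'k) layer = "'m expr \<times> ('m, ('m, 'k) R) piece \<times> 'm expr"
type_synonym ('m, 'k) graph = "('m, 'k) layer list"

fun soergel_graph :: "'m::nontriv expr \<Rightarrow> ('m, 'k::field) graph \<Rightarrow> 'm expr \<Rightarrow> bool" where
  "soergel_graph u [] v \<longleftrightarrow> u = v"
| "soergel_graph u ((l, g, r) # p) v \<longleftrightarrow>
     admissible g \<and> u = l @ src g @ r \<and> soergel_graph (l @ tgt g @ r) p v"

definition whisker :: "'m expr \<Rightarrow> 'm expr \<Rightarrow> ('m, 'k::field) graph \<Rightarrow> ('m, 'k) graph" where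
  "whisker x y p = map (\<lambda>(l, g, r). (x @ l, g, r @ y)) p"

type_synonym ('m, 'k) mor = "('m, 'k) graph \<Rightarrow>\<^sub>0 'k"

abbreviation gr :: "('m, 'k::field) graph \<Rightarrow> ('m, 'k) mor" where
  "gr p \<equiv> Poly_Mapping.single p 1"

definition scal :: "'k::field \<Rightarrow> ('x \<Rightarrow>\<^sub>0 'k) \<Rightarrow> ('x \<Rightarrow>\<^sub>0 'k)" where
  "scal c f = Poly_Mapping.map ((*) c) f"

lemma lookup_scal: "Poly_Mapping.lookup (scal c f) x = c * Poly_Mapping.lookup f x"
  by (simp add: scal_def Poly_Mapping.map.rep_eq when_def)

interpretation pm: vector_space "scal :: 'k::field \<Rightarrow> ('x \<Rightarrow>\<^sub>0 'k) \<Rightarrow> ('x \<Rightarrow>\<^sub>0 'k)"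
  by unfold_locales
    (auto intro!: poly_mapping_eqI simp: lookup_scal Poly_Mapping.lookup_add algebra_simps)

definition free_hom :: "'m::nontriv expr \<Rightarrow> 'm expr \<Rightarrow> ('m, 'k::field) mor set" where
  "free_hom u v = {f. \<forall>p\<in>Poly_Mapping.keys f. soergel_graph u p v}"

text \<open>Vertical concatenation, \<open>y\<close> on top of \<open>x\<close>.\<close>

definition vcomp :: "('m, 'k::field) mor \<Rightarrow> ('m, 'k) mor \<Rightarrow> ('m, 'k) mor" where
  "vcomp y x =
    (\<Sum>q\<in>Poly_Mapping.keys y. \<Sum>p\<in>Poly_Mapping.keys x.
       Poly_Mapping.single (p @ q) (Poly_Mapping.lookup y q * Poly_Mapping.lookup x p))"

text \<open>Replacing a window of a graph: the graph \<open>p\<close> below, \<open>q\<close> above, strands \<open>l\<close>, \<open>r\<close> beside.\<close>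

definition in_context ::
  "('m, 'k::field) graph \<Rightarrow> 'm expr \<Rightarrow> 'm expr \<Rightarrow> ('m, 'k) graph \<Rightarrow> ('m, 'k) mor \<Rightarrow> ('m, 'k) mor"
where
  "in_context p l r q x =
    (\<Sum>s\<in>Poly_Mapping.keys x.
       Poly_Mapping.single (p @ whisker l r s @ q) (Poly_Mapping.lookup x s))"


section \<open>The diagrammatic Soergel category\<close>

text \<open>
  \<open>local_rel u v x y\<close> is the local relation \<open>x = y\<close> between linear combinations of graphs with
  bottom boundary \<open>u\<close> and top boundary \<open>v\<close>.

  The first block expresses isotopy: pieces may be moved past each other vertically,
  strands may be straightened, and every vertex may be rotated.  (The rotations not listed
  follow by straightening.)

  In affine type A all finite $m(a,b)$ with $a \ne b$ are 2 or 3, so the Jones--Wenzl relation is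
  spelled out for these two values, and the finite rank three parabolic subgroups have types
  $A_1 \times A_1 \times A_1$, $A_2 \times A_1$ and $A_3$.
  The Zamolodchikov relation of type $A_3$ equates the two halves of the cycle
  in the reduced expression graph of the longest element that join the classes of
  \<open>[a,b,a,c,b,a]\<close> and \<open>[c,b,c,a,b,c]\<close>, where \<open>a\<close> and \<open>c\<close> commute.
  (For antipodal reduced expressions such as \<open>[b,a,b,c,b,a]\<close> and \<open>[c,b,a,b,c,b]\<close> the
  two halves do not agree.)
\<close>

inductive local_rel ::
  "'m::nontriv expr \<Rightarrow> 'm expr \<Rightarrow> ('m, 'k::field) mor \<Rightarrow> ('m, 'k) mor \<Rightarrow> bool"
where
  interchange:
    "admissible g \<Longrightarrow> admissible h \<Longrightarrow>
     local_rel (src g @ w @ src h) (tgt g @ w @ tgt h)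
       (gr [([], g, w @ src h), (tgt g @ w, h, [])])
       (gr [(src g @ w, h, []), ([], g, w @ tgt h)])"
| zigzag_right:
    "local_rel [a] [a] (gr [([a], Cup a, []), ([], Cap a, [a])]) (gr [])"
| zigzag_left:
    "local_rel [a] [a] (gr [([], Cup a, [a]), ([a], Cap a, [])]) (gr [])"
| rotate_dot_right:
    "local_rel [a] [] (gr [([a], StartDot a, []), ([], Cap a, [])]) (gr [([], EndDot a, [])])"
| rotate_dot_left:
    "local_rel [a] [] (gr [([], StartDot a, [a]), ([], Cap a, [])]) (gr [([], EndDot a, [])])"
| rotate_trivalent_right:
    "local_rel [a] [a, a] (gr [([a], Cup a, []), ([], Merge a, [a])]) (gr [([], Split a, [])])"
| rotate_trivalent_left:
    "local_rel [a] [a, a] (gr [([], Cup a, [a]), ([a], Merge a, [])]) (gr [([], Split a, [])])"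
| rotate_vertex:
    "a \<noteq> b \<Longrightarrow> cox a b = n \<Longrightarrow> n \<noteq> 0 \<Longrightarrow> z = last (alt b a n) \<Longrightarrow>
     local_rel (alt b a n) (alt a b n)
       (gr [([], Cup a, alt b a n), ([a], Vertex a b, [z]), (alt a b n, Cap z, [])])
       (gr [([], Vertex b a, [])])"

| box_add:
    "homogeneous d f \<Longrightarrow> homogeneous d g \<Longrightarrow>
     local_rel [] [] (gr [([], Box (f + g), [])]) (gr [([], Box f, [])] + gr [([], Box g, [])])"
| box_scal:
    "homogeneous d f \<Longrightarrow>
     local_rel [] [] (gr [([], Box (scal c f), [])]) (scal c (gr [([], Box f, [])]))"
| box_mult:
    "homogeneous d f \<Longrightarrow> homogeneous e g \<Longrightarrow>
     local_rel [] [] (gr [([], Box f, []), ([], Box g, [])]) (gr [([], Box (f * g), [])])"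
| box_one:
    "local_rel [] [] (gr [([], Box 1, [])]) (gr [])"

| barbell:
    "local_rel [] [] (gr [([], StartDot a, []), ([], EndDot a, [])]) (gr [([], Box (simple_root a), [])])"
| forcing:
    "homogeneous d f \<Longrightarrow>
     local_rel [a] [a] (gr [([a], Box f, [])])
       (gr [([], Box (refl_act a f), [a])] +
        gr [([], EndDot a, []), ([], Box (demazure a f), []), ([], StartDot a, [])])"
| unit_left:
    "local_rel [a] [a] (gr [([], StartDot a, [a]), ([], Merge a, [])]) (gr [])"
| unit_right:
    "local_rel [a] [a] (gr [([a], StartDot a, []), ([], Merge a, [])]) (gr [])"
| frobenius:
    "local_rel [a, a] [a, a]
       (gr [([], Split a, [a]), ([a], Merge a, [])])
       (gr [([], Merge a, []), ([], Split a, [])])"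
| needle:
    "local_rel [a] [a] (gr [([], Split a, []), ([], Merge a, [])]) 0"

| two_color_assoc:
    "a \<noteq> b \<Longrightarrow> cox a b = n \<Longrightarrow> n \<noteq> 0 \<Longrightarrow> z = last (alt b a n) \<Longrightarrow>
     local_rel (a # alt a b n) (alt b a n)
       (gr [([], Merge a, alt b a (n - 1)), ([], Vertex a b, [])])
       (gr [([a], Vertex a b, []), ([], Vertex a b, [z]), (alt b a (n - 1), Merge z, [])])"
| jones_wenzl_2:
    "cox a b = 2 \<Longrightarrow>
     local_rel [b] [b, a]
       (gr [([], StartDot a, [b]), ([], Vertex a b, [])])
       (gr [([b], StartDot a, [])])"
| jones_wenzl_3:
    "cox a b = 3 \<Longrightarrow>
     local_rel [b, a] [b, a, b]
       (gr [([], StartDot a, [b, a]), ([], Vertex a b, [])])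
       (gr [([b, a], StartDot b, [])] +
        gr [([b], EndDot a, []), ([], Split b, []), ([b], StartDot a, [b])])"

| zamolodchikov_A1_A1_A1:
    "cox a b = 2 \<Longrightarrow> cox a c = 2 \<Longrightarrow> cox b c = 2 \<Longrightarrow>
     local_rel [a, b, c] [c, b, a]
       (gr [([], Vertex a b, [c]), ([b], Vertex a c, []), ([], Vertex b c, [a])])
       (gr [([a], Vertex b c, []), ([], Vertex a c, [b]), ([c], Vertex a b, [])])"
| zamolodchikov_A2_A1:
    "cox a b = 3 \<Longrightarrow> cox a c = 2 \<Longrightarrow> cox b c = 2 \<Longrightarrow>
     local_rel [a, b, a, c] [c, b, a, b]
       (gr [([], Vertex a b, [c]),
            ([b, a], Vertex b c, []), ([b], Vertex a c, [b]), ([], Vertex b c, [a, b])])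
       (gr [([a, b], Vertex a c, []), ([a], Vertex b c, [a]), ([], Vertex a c, [b, a]),
            ([c], Vertex a b, [])])"
| zamolodchikov_A3:
    "cox a b = 3 \<Longrightarrow> cox b c = 3 \<Longrightarrow> cox a c = 2 \<Longrightarrow>
     local_rel [a, b, a, c, b, a] [c, b, c, a, b, c]
       (gr [([], Vertex a b, [c, b, a]),
            ([b, a], Vertex b c, [a]),
            ([b], Vertex a c, [b, c, a]),
            ([b, c, a, b], Vertex c a, []),
            ([b, c], Vertex a b, [c]),
            ([], Vertex b c, [a, b, c])])
       (gr [([a, b], Vertex a c, [b, a]),
            ([a, b, c], Vertex a b, []),
            ([a], Vertex b c, [a, b]),
            ([], Vertex a c, [b, c, a, b]),
            ([c, a, b], Vertex c a, [b]),
            ([c], Vertex a b, [c, b]),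
            ([c, b, a], Vertex b c, []),
            ([c, b], Vertex a c, [b, c])])"

text \<open>
  The morphisms from \<open>u\<close> to \<open>v\<close> that vanish in the category: the span of all instances of the
  local relations inside larger graphs, and of all graphs with a homogeneous decoration of
  positive degree in the leftmost region.
\<close>

definition null_hom :: "'m::nontriv expr \<Rightarrow> 'm expr \<Rightarrow> ('m, 'k::field) mor set" where
  "null_hom u v = pm.span
    ({in_context p l r q (x - y) | p l r q x y d e.
        soergel_graph u p (l @ d @ r) \<and> soergel_graph (l @ e @ r) q v \<and> local_rel d e x y} \<union>
     {gr (p @ [([], Box f, w)] @ q) | p f w q d.
        soergel_graph u p w \<and> soergel_graph w q v \<and> homogeneous d f \<and> d > 0})"

definition free_End :: "'m::nontriv expr \<Rightarrow> ('m, 'k::field) mor ring" where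
  "free_End u = \<lparr>carrier = free_hom u u, monoid.mult = vcomp, one = gr [], zero = 0, add = (+)\<rparr>"

definition End :: "'m::nontriv expr \<Rightarrow> ('k::field, ('m, 'k) mor set) module" where
  "End u = ring.extend (free_End u Quot null_hom u u)
     (module.fields (\<lambda>c X. \<Union>x\<in>X. null_hom u u +>\<^bsub>free_End u\<^esub> scal c x))"


section \<open>The Gelfand--Tsetlin subalgebra\<close>

inductive_set subalgebra_gen :: "('k, 'a, 'x) module_scheme \<Rightarrow> 'a set \<Rightarrow> 'a set"
  for A :: "('k, 'a, 'x) module_scheme" and G :: "'a set"
where
  gen: "x \<in> G \<Longrightarrow> x \<in> subalgebra_gen A G"
| one: "\<one>\<^bsub>A\<^esub> \<in> subalgebra_gen A G"
| add: "x \<in> subalgebra_gen A G \<Longrightarrow> y \<in> subalgebra_gen A G \<Longrightarrow> x \<oplus>\<^bsub>A\<^esub> y \<in> subalgebra_gen A G"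
| mult: "x \<in> subalgebra_gen A G \<Longrightarrow> y \<in> subalgebra_gen A G \<Longrightarrow> x \<otimes>\<^bsub>A\<^esub> y \<in> subalgebra_gen A G"
| smult: "x \<in> subalgebra_gen A G \<Longrightarrow> c \<odot>\<^bsub>A\<^esub> x \<in> subalgebra_gen A G"

text \<open>Strands are counted from 0.\<close>

definition broken :: "'m::nontriv expr \<Rightarrow> nat \<Rightarrow> ('m, 'k::field) graph" where
  "broken u k = [(take k u, EndDot (u ! k), drop (Suc k) u),
                 (take k u, StartDot (u ! k), drop (Suc k) u)]"

definition JJ :: "'m::nontriv expr \<Rightarrow> nat \<Rightarrow> ('m, 'k::field) mor set" where
  "JJ u k = null_hom u u +>\<^bsub>free_End u\<^esub> gr (broken u k)"

definition GT :: "'m::nontriv expr \<Rightarrow> ('k::field, ('m, 'k) mor set) module" where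
  "GT u = (End u)\<lparr>carrier := subalgebra_gen (End u) {JJ u k | k. k < length u}\<rparr>"

definition alg_iso :: "('k, 'a, 'x) module_scheme \<Rightarrow> ('k, 'b, 'y) module_scheme \<Rightarrow> ('a \<Rightarrow> 'b) set" where
  "alg_iso A B =
    {h \<in> ring_iso A B. \<forall>c. \<forall>x\<in>carrier A. h (c \<odot>\<^bsub>A\<^esub> x) = c \<odot>\<^bsub>B\<^esub> h x}"

definition alg_isomorphic :: "('k, 'a, 'x) module_scheme \<Rightarrow> ('k, 'b, 'y) module_scheme \<Rightarrow> bool" where
  "alg_isomorphic A B \<longleftrightarrow> alg_iso A B \<noteq> {}"

end

theory Submission
  imports Defs
begin

text \<open>
  The crossing of two commuting colors is invertible in the category, its inverse being the crossing
  in the other direction, and dots slide through it.  Hence conjugation by the crossing carries each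
  broken strand of \<open>u\<close> to a broken strand of \<open>v\<close>, and so restricts to an
  isomorphism of the algebras these generate.  For the quotient to be a ring, the relations must have
  well-formed graphs on both sides; the only problem is polynomial forcing, where the Demazure
  operator must preserve homogeneity.  This is where the characteristic enters: a simple root
  is not a zero divisor when 2 is nonzero.
\<close>

section \<open>Linear combinations of graphs\<close>

text \<open>That two opposite crossings cancel is not itself one of the relations. For commuting
  colors they provide the rotation of a crossing, two-color associativity, and the removal of a
  crossing with a start dot on its lower left leg. The rules for dots on other legs have to be
  derived from these by bending strands, and the cancellation comes from associativity because a cap
  is a merge with a dotted leg. Every relation used for this equates two single graphs with
  coefficient one. The diagrammatic part can therefore be carried out on lists of layers; linear
  combinations return only when classes of morphisms are formed. Conjugation respects products
  because the two inner crossings cancel. Exchanging \<open>b\<close> and \<open>c\<close> gives the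
  conjugation back, so it is enough that generators go to generators in both directions.\<close>

lemma poly_mapping_eq_sum_single:
  fixes f :: "'a \<Rightarrow>\<^sub>0 'b::comm_monoid_add"
  shows "f = (\<Sum>p\<in>Poly_Mapping.keys f. Poly_Mapping.single p (Poly_Mapping.lookup f p))"
  by (rule poly_mapping_eqI) (simp add: lookup_sum lookup_single when_def in_keys_iff)

text \<open>Reduces additive statements to single graphs. The bound \<open>K\<close> on the support
  lets \<open>free_hom_induct\<close> assume that these graphs have the right boundary.\<close>

lemma poly_mapping_keys_induct [consumes 1, case_names zero single add]:
  fixes f :: "'a \<Rightarrow>\<^sub>0 'b::comm_monoid_add"
  assumes "Poly_Mapping.keys f \<subseteq> K"
    and "P 0"
    and "\<And>p c. p \<in> K \<Longrightarrow> P (Poly_Mapping.single p c)"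
    and "\<And>f g. P f \<Longrightarrow> P g \<Longrightarrow> P (f + g)"
  shows "P f"
proof -
  have "P (\<Sum>p\<in>A. Poly_Mapping.single p (Poly_Mapping.lookup f p))"
    if "finite A" "A \<subseteq> K" for A
    using that by (induction A rule: finite_induct) (simp_all add: assms(2-4))
  then show ?thesis
    using assms(1) by (subst poly_mapping_eq_sum_single) simp
qed

lemmas poly_mapping_single_induct [case_names zero single add] =
  poly_mapping_keys_induct[OF subset_UNIV, simplified]

lemma scal_single [simp]: "scal c (Poly_Mapping.single p d) = Poly_Mapping.single p (c * d)"
  by (rule poly_mapping_eqI) (simp add: lookup_scal lookup_single when_def)

lemma scal_zero [simp]: "scal c 0 = 0"
  by (rule poly_mapping_eqI) (simp add: lookup_scal)

lemma keys_scal_subset: "Poly_Mapping.keys (scal c f) \<subseteq> Poly_Mapping.keys f"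
  by (auto simp: in_keys_iff lookup_scal)

text \<open>The definition sums over exact supports, and these may shrink by cancellation when
  morphisms are added. With arbitrary finite index sets containing them, bilinearity can be read off
  termwise.\<close>

lemma vcomp_eq_sum:
  assumes "finite A" "Poly_Mapping.keys y \<subseteq> A" "finite B" "Poly_Mapping.keys x \<subseteq> B"
  shows "vcomp y x = (\<Sum>q\<in>A. \<Sum>p\<in>B.
    Poly_Mapping.single (p @ q) (Poly_Mapping.lookup y q * Poly_Mapping.lookup x p))"
proof -
  have "vcomp y x = (\<Sum>q\<in>Poly_Mapping.keys y. \<Sum>p\<in>B.
      Poly_Mapping.single (p @ q) (Poly_Mapping.lookup y q * Poly_Mapping.lookup x p))"
    unfolding vcomp_def using assms
    by (intro sum.cong refl sum.mono_neutral_left) (auto simp: in_keys_iff)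
  also have "\<dots> = (\<Sum>q\<in>A. \<Sum>p\<in>B.
      Poly_Mapping.single (p @ q) (Poly_Mapping.lookup y q * Poly_Mapping.lookup x p))"
    using assms by (intro sum.mono_neutral_left) (auto simp: in_keys_iff)
  finally show ?thesis .
qed

lemma vcomp_add_left: "vcomp (y + y') x = vcomp y x + vcomp y' x"
  using keys_add[of y y']
  by (subst (1 2 3) vcomp_eq_sum[where A = "Poly_Mapping.keys y \<union> Poly_Mapping.keys y'"
        and B = "Poly_Mapping.keys x"])
    (auto simp: lookup_add single_add distrib_right sum.distrib)

lemma vcomp_add_right: "vcomp y (x + x') = vcomp y x + vcomp y x'"
  using keys_add[of x x']
  by (subst (1 2 3) vcomp_eq_sum[where A = "Poly_Mapping.keys y"
        and B = "Poly_Mapping.keys x \<union> Poly_Mapping.keys x'"])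
    (auto simp: lookup_add single_add distrib_left sum.distrib)

lemma vcomp_zero_left [simp]: "vcomp 0 x = 0"
  by (simp add: vcomp_def)

lemma vcomp_zero_right [simp]: "vcomp y 0 = 0"
  by (simp add: vcomp_def)

lemma vcomp_single [simp]:
  "vcomp (Poly_Mapping.single q c) (Poly_Mapping.single p d) = Poly_Mapping.single (p @ q) (c * d)"
  by (subst vcomp_eq_sum[where A = "{q}" and B = "{p}"]) auto

lemma vcomp_scal_left: "vcomp (scal c y) x = scal c (vcomp y x)"
proof (induction y rule: poly_mapping_single_induct)
  case (single q d)
  show ?case
    by (induction x rule: poly_mapping_single_induct)
      (simp_all add: vcomp_add_right pm.scale_right_distrib mult.assoc)
qed (simp_all add: vcomp_add_left pm.scale_right_distrib)

lemma vcomp_scal_right: "vcomp y (scal c x) = scal c (vcomp y x)"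
proof (induction y rule: poly_mapping_single_induct)
  case (single q d)
  show ?case
    by (induction x rule: poly_mapping_single_induct)
      (simp_all add: vcomp_add_right pm.scale_right_distrib mult.left_commute)
qed (simp_all add: vcomp_add_left pm.scale_right_distrib)

lemma vcomp_diff_left: "vcomp (y - y') x = vcomp y x - vcomp y' x"
  using vcomp_add_left[of "y - y'" y' x] by simp

lemma vcomp_diff_right: "vcomp y (x - x') = vcomp y x - vcomp y x'"
  using vcomp_add_right[of y "x - x'" x'] by simp

lemma vcomp_assoc: "vcomp (vcomp z y) x = vcomp z (vcomp y x)"
proof (induction z rule: poly_mapping_single_induct)
  case (single r c)
  show ?case
  proof (induction y rule: poly_mapping_single_induct)
    case (single q d)
    show ?case
      by (induction x rule: poly_mapping_single_induct)
        (simp_all add: vcomp_add_right mult.assoc)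
  qed (simp_all add: vcomp_add_left vcomp_add_right)
qed (simp_all add: vcomp_add_left)

lemma vcomp_gr_Nil_left [simp]: "vcomp (gr []) x = x"
  by (induction x rule: poly_mapping_single_induct)
    (simp_all add: vcomp_add_right)

lemma vcomp_gr_Nil_right [simp]: "vcomp x (gr []) = x"
  by (induction x rule: poly_mapping_single_induct)
    (simp_all add: vcomp_add_left)

section \<open>Linear combinations placed in a window of a graph\<close>

lemma in_context_eq_sum:
  assumes "finite A" "Poly_Mapping.keys x \<subseteq> A"
  shows "in_context p l r q x =
    (\<Sum>s\<in>A. Poly_Mapping.single (p @ whisker l r s @ q) (Poly_Mapping.lookup x s))"
  unfolding in_context_def using assms
  by (intro sum.mono_neutral_left) (auto simp: in_keys_iff)

lemma in_context_zero [simp]: "in_context p l r q 0 = 0"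
  by (simp add: in_context_def)

lemma in_context_single [simp]:
  "in_context p l r q (Poly_Mapping.single s c) = Poly_Mapping.single (p @ whisker l r s @ q) c"
  by (subst in_context_eq_sum[where A = "{s}"]) auto

lemma in_context_add: "in_context p l r q (x + y) = in_context p l r q x + in_context p l r q y"
  using keys_add[of x y]
  by (subst (1 2 3) in_context_eq_sum[where A = "Poly_Mapping.keys x \<union> Poly_Mapping.keys y"])
    (auto simp: lookup_add single_add sum.distrib)

lemma in_context_diff: "in_context p l r q (x - y) = in_context p l r q x - in_context p l r q y"
  using in_context_add[of p l r q "x - y" y] by simp

text \<open>A graph stacked on top only lengthens the part above the window, so an instance of a
  local relation remains one.\<close>

lemma vcomp_single_in_context:
  "vcomp (Poly_Mapping.single s c) (in_context p l r q x) = scal c (in_context p l r (q @ s) x)"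
  by (induction x rule: poly_mapping_single_induct)
    (simp_all add: in_context_add vcomp_add_right pm.scale_right_distrib)

lemma vcomp_in_context_single:
  "vcomp (in_context p l r q x) (Poly_Mapping.single s c) = scal c (in_context (s @ p) l r q x)"
  by (induction x rule: poly_mapping_single_induct)
    (simp_all add: in_context_add vcomp_add_left pm.scale_right_distrib mult.commute)


section \<open>Hom spaces\<close>

lemma soergel_graph_append:
  "soergel_graph u (p @ q) w \<longleftrightarrow> (\<exists>v. soergel_graph u p v \<and> soergel_graph v q w)"
  by (induction u p w rule: soergel_graph.induct) auto

lemma soergel_graph_whisker:
  "soergel_graph u p v \<Longrightarrow> soergel_graph (x @ u @ y) (whisker x y p) (x @ v @ y)"
  by (induction u p v rule: soergel_graph.induct) (auto simp: whisker_def)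

lemma free_hom_zero [simp]: "0 \<in> free_hom u v"
  by (simp add: free_hom_def)

lemma free_hom_single [simp]:
  "Poly_Mapping.single p c \<in> free_hom u v \<longleftrightarrow> c = 0 \<or> soergel_graph u p v"
  by (simp add: free_hom_def)

lemma free_hom_add [intro]: "f \<in> free_hom u v \<Longrightarrow> g \<in> free_hom u v \<Longrightarrow> f + g \<in> free_hom u v"
  using keys_add[of f g] by (auto simp: free_hom_def)

lemma free_hom_scal [intro]: "f \<in> free_hom u v \<Longrightarrow> scal c f \<in> free_hom u v"
  using keys_scal_subset[of c f] by (auto simp: free_hom_def)

lemma free_hom_uminus [intro]: "f \<in> free_hom u v \<Longrightarrow> - f \<in> free_hom u v"
  by (auto simp: free_hom_def in_keys_iff)

lemma free_hom_diff [intro]: "f \<in> free_hom u v \<Longrightarrow> g \<in> free_hom u v \<Longrightarrow> f - g \<in> free_hom u v"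
  using free_hom_add[of f u v "- g"] free_hom_uminus[of g u v] by simp

lemma free_hom_induct [consumes 1, case_names zero single add]:
  assumes "f \<in> free_hom u v"
    and "P 0"
    and "\<And>p c. soergel_graph u p v \<Longrightarrow> P (Poly_Mapping.single p c)"
    and "\<And>f g. P f \<Longrightarrow> P g \<Longrightarrow> P (f + g)"
  shows "P f"
proof (rule poly_mapping_keys_induct[where K = "{p. soergel_graph u p v}" and P = P])
  show "Poly_Mapping.keys f \<subseteq> {p. soergel_graph u p v}"
    using assms(1) by (auto simp: free_hom_def)
  show "P (Poly_Mapping.single p c)" if "p \<in> {p. soergel_graph u p v}" for p c
    using that assms(3) by simp
qed fact+

lemma vcomp_free_hom [intro]:
  assumes "y \<in> free_hom v w" "x \<in> free_hom u v"
  shows "vcomp y x \<in> free_hom u w"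
  using assms(1)
proof (induction y rule: free_hom_induct)
  case (single q c)
  show ?case
    using assms(2)
  proof (induction x rule: free_hom_induct)
    case (single p d)
    then show ?case
      using \<open>soergel_graph v q w\<close> by (auto simp: soergel_graph_append)
  qed (auto simp: vcomp_add_right)
qed (auto simp: vcomp_add_left)

lemma in_context_free_hom:
  assumes "soergel_graph u p (l @ d @ r)" "soergel_graph (l @ e @ r) q v" "x \<in> free_hom d e"
  shows "in_context p l r q x \<in> free_hom u v"
  using assms(3)
proof (induction x rule: free_hom_induct)
  case (single s c)
  then show ?case
    using assms(1,2) soergel_graph_whisker[of d s e l r] by (auto simp: soergel_graph_append)
qed (auto simp: in_context_add)

section \<open>The vanishing morphisms as a two-sided ideal\<close>

lemma null_hom_zero [simp]: "0 \<in> null_hom u v"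
  unfolding null_hom_def by (rule pm.span_zero)

lemma null_hom_add [intro]: "f \<in> null_hom u v \<Longrightarrow> g \<in> null_hom u v \<Longrightarrow> f + g \<in> null_hom u v"
  unfolding null_hom_def by (rule pm.span_add)

lemma null_hom_scal [intro]: "f \<in> null_hom u v \<Longrightarrow> scal c f \<in> null_hom u v"
  unfolding null_hom_def by (rule pm.span_scale)

lemma null_hom_uminus [intro]: "f \<in> null_hom u v \<Longrightarrow> - f \<in> null_hom u v"
  unfolding null_hom_def by (rule pm.span_neg)

lemma null_hom_diff [intro]: "f \<in> null_hom u v \<Longrightarrow> g \<in> null_hom u v \<Longrightarrow> f - g \<in> null_hom u v"
  unfolding null_hom_def by (rule pm.span_diff)

lemma null_hom_local:
  assumes "soergel_graph u p (l @ d @ r)" "soergel_graph (l @ e @ r) q v" "local_rel d e x y"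
  shows "in_context p l r q (x - y) \<in> null_hom u v"
  unfolding null_hom_def using assms by (intro pm.span_base) blast

lemma null_hom_annihilation:
  assumes "soergel_graph u p w" "soergel_graph w q v" "homogeneous d f" "d > 0"
  shows "gr (p @ [([], Box f, w)] @ q) \<in> null_hom u v"
  unfolding null_hom_def using assms by (intro pm.span_base) blast

lemma null_hom_induct [consumes 1, case_names local annihilation zero scal add]:
  assumes "f \<in> null_hom u v"
    and "\<And>p l r q x y d e. soergel_graph u p (l @ d @ r) \<Longrightarrow> soergel_graph (l @ e @ r) q v \<Longrightarrow>
      local_rel d e x y \<Longrightarrow> P (in_context p l r q (x - y))"
    and "\<And>p f w q d. soergel_graph u p w \<Longrightarrow> soergel_graph w q v \<Longrightarrow> homogeneous d f \<Longrightarrow> d > 0 \<Longrightarrow>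
      P (gr (p @ [([], Box f, w)] @ q))"
    and "P 0"
    and "\<And>c f. P f \<Longrightarrow> P (scal c f)"
    and "\<And>f g. P f \<Longrightarrow> P g \<Longrightarrow> P (f + g)"
  shows "P f"
  using assms(1) unfolding null_hom_def
proof (induction rule: pm.span_induct_alt)
  case base
  show ?case by fact
next
  case (step c g h)
  then have "P g"
    using assms(2,3) by blast
  then show ?case
    using step by (intro assms(5,6)) auto
qed

text \<open>Both kinds of generators survive stacking: a window stays a window, and a decoration
  with no strand to its left stays leftmost whatever lies above it.\<close>

lemma null_hom_vcomp_left:
  assumes "y \<in> free_hom v w" "n \<in> null_hom u v"
  shows "vcomp y n \<in> null_hom u w"
  using assms(1)
proof (induction y rule: free_hom_induct)
  case (single s c)
  show ?case
    using assms(2)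
  proof (induction n rule: null_hom_induct)
    case (local p l r q x y d e)
    then show ?case
      unfolding vcomp_single_in_context using single
      by (intro null_hom_scal null_hom_local[OF _ _ local(3)]) (auto simp: soergel_graph_append)
  next
    case (annihilation p f w' q d)
    then have "gr (p @ [([], Box f, w')] @ q @ s) \<in> null_hom u w"
      using single by (intro null_hom_annihilation[OF _ _ annihilation(3,4)]) (auto simp: soergel_graph_append)
    from null_hom_scal[OF this, of c] show ?case
      by simp
  qed (auto simp: vcomp_add_right vcomp_scal_right)
qed (auto simp: vcomp_add_left)

lemma null_hom_vcomp_right:
  assumes "n \<in> null_hom v w" "x \<in> free_hom u v"
  shows "vcomp n x \<in> null_hom u w"
  using assms(2)
proof (induction x rule: free_hom_induct)
  case (single s c)
  show ?case
    using assms(1)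
  proof (induction n rule: null_hom_induct)
    case (local p l r q x y d e)
    then show ?case
      unfolding vcomp_in_context_single using single
      by (intro null_hom_scal null_hom_local[OF _ _ local(3)]) (auto simp: soergel_graph_append)
  next
    case (annihilation p f w' q d)
    then have "gr ((s @ p) @ [([], Box f, w')] @ q) \<in> null_hom u w"
      using single by (intro null_hom_annihilation[OF _ _ annihilation(3,4)]) (auto simp: soergel_graph_append)
    from null_hom_scal[OF this, of c] show ?case
      by simp
  qed (auto simp: vcomp_add_left vcomp_scal_left)
qed (auto simp: vcomp_add_right)


section \<open>Homogeneity\<close>

lemma homogeneous_zero [simp]: "homogeneous d 0"
  by (simp add: homogeneous_def)

lemma homogeneous_single:
  "homogeneous d (Poly_Mapping.single t c) \<longleftrightarrow> c = 0 \<or> 2 * (\<Sum>b\<in>UNIV. Poly_Mapping.lookup t b) = d"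
  by (simp add: homogeneous_def)

lemma homogeneous_add: "homogeneous d f \<Longrightarrow> homogeneous d g \<Longrightarrow> homogeneous d (f + g)"
  using keys_add[of f g] by (auto simp: homogeneous_def)

lemma homogeneous_diff: "homogeneous d f \<Longrightarrow> homogeneous d g \<Longrightarrow> homogeneous d (f - g)"
  using keys_diff[of f g] by (auto simp: homogeneous_def)

lemma homogeneous_scal: "homogeneous d f \<Longrightarrow> homogeneous d (scal c f)"
  using keys_scal_subset[of c f] by (auto simp: homogeneous_def)

lemma homogeneous_sum: "(\<And>i. i \<in> A \<Longrightarrow> homogeneous d (f i)) \<Longrightarrow> homogeneous d (sum f A)"
  by (induction A rule: infinite_finite_induct) (auto intro: homogeneous_add)

lemma homogeneous_mult:
  assumes "homogeneous d f" "homogeneous e g"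
  shows "homogeneous (d + e) (f * g)"
  unfolding homogeneous_def
proof
  fix t assume "t \<in> Poly_Mapping.keys (f * g)"
  then obtain r s where "t = r + s" "r \<in> Poly_Mapping.keys f" "s \<in> Poly_Mapping.keys g"
    using keys_mult[of f g] by blast
  then show "2 * (\<Sum>b\<in>UNIV. Poly_Mapping.lookup t b) = d + e"
    using assms by (auto simp: homogeneous_def lookup_add sum.distrib)
qed

lemma homogeneous_one: "homogeneous 0 1"
  by (simp add: homogeneous_def)

lemma homogeneous_power: "homogeneous d f \<Longrightarrow> homogeneous (d * n) (f ^ n)"
  by (induction n) (auto simp: homogeneous_one intro: homogeneous_mult)

lemma homogeneous_prod:
  "(\<And>i. i \<in> A \<Longrightarrow> homogeneous (d i) (f i)) \<Longrightarrow> homogeneous (sum d A) (prod f A)"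
  by (induction A rule: infinite_finite_induct) (auto intro: homogeneous_mult homogeneous_one)

lemma sum_lookup_single [simp]:
  "(\<Sum>b\<in>UNIV. Poly_Mapping.lookup (Poly_Mapping.single (a :: 'm::nontriv mod_ring) n) b) = (n :: nat)"
  by (simp add: lookup_single when_def)

lemma homogeneous_var: "homogeneous 2 (var b)"
  by (simp add: var_def homogeneous_single)

lemma homogeneous_simple_root: "homogeneous 2 (simple_root a)"
  unfolding simple_root_def by (intro homogeneous_sum) (simp add: homogeneous_single)

lemma homogeneous_const: "homogeneous 0 (Poly_Mapping.single 0 c)"
  by (simp add: homogeneous_single)

lemma homogeneous_poly_subst:
  assumes "homogeneous d f" "\<And>b. homogeneous 2 (\<sigma> b)"
  shows "homogeneous d (poly_subst \<sigma> f)"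
  unfolding poly_subst_def
proof (rule homogeneous_sum)
  fix t assume "t \<in> Poly_Mapping.keys f"
  then have d: "d = 0 + (\<Sum>b\<in>UNIV. 2 * Poly_Mapping.lookup t b)"
    using assms(1) by (simp add: homogeneous_def sum_distrib_left)
  show "homogeneous d (Poly_Mapping.single 0 (Poly_Mapping.lookup f t) *
      (\<Prod>b\<in>UNIV. \<sigma> b ^ Poly_Mapping.lookup t b))"
    unfolding d
    by (intro homogeneous_mult homogeneous_const homogeneous_prod homogeneous_power assms(2))
qed

lemma homogeneous_refl_act: "homogeneous d f \<Longrightarrow> homogeneous d (refl_act a f)"
  unfolding refl_act_def
  by (rule homogeneous_poly_subst) (auto intro: homogeneous_diff homogeneous_var homogeneous_simple_root)


section \<open>Demazure operators\<close>

lemma var_power: "var b ^ n = Poly_Mapping.single (Poly_Mapping.single b n) 1"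
  by (induction n) (simp_all add: var_def mult_single flip: single_add)

lemma prod_single_one:
  "(\<Prod>i\<in>A. Poly_Mapping.single (s i) (1 :: 'k::comm_semiring_1)) = Poly_Mapping.single (sum s A) 1"
  by (induction A rule: infinite_finite_induct) (simp_all add: mult_single)

lemma prod_var_power:
  "(\<Prod>b\<in>UNIV. var b ^ Poly_Mapping.lookup t b) = Poly_Mapping.single t 1"
proof -
  have "(\<Sum>b\<in>UNIV. Poly_Mapping.single b (Poly_Mapping.lookup t b)) = t"
    by (rule poly_mapping_eqI) (simp add: lookup_sum lookup_single when_def)
  then show ?thesis
    by (simp add: var_power prod_single_one)
qed

text \<open>Presents \<open>f\<close> itself as a substitution, so that
  \<open>f - refl_act a f\<close> can be treated monomial by monomial.\<close>

lemma poly_subst_var: "poly_subst var f = f"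
proof -
  have "poly_subst var f = (\<Sum>t\<in>Poly_Mapping.keys f. Poly_Mapping.single t (Poly_Mapping.lookup f t))"
    unfolding poly_subst_def prod_var_power by (simp add: mult_single)
  also have "\<dots> = f"
    by (rule poly_mapping_eq_sum_single[symmetric])
  finally show ?thesis .
qed

lemma lookup_single_mult:
  fixes h :: "'a::comm_monoid_add \<Rightarrow>\<^sub>0 'k::comm_semiring_1"
  shows "Poly_Mapping.lookup (Poly_Mapping.single s c * h) u =
    (\<Sum>t\<in>Poly_Mapping.keys h. c * Poly_Mapping.lookup h t when s + t = u)"
  by (subst (1) poly_mapping_eq_sum_single[of h])
    (simp add: sum_distrib_left mult_single lookup_sum lookup_single)

text \<open>
  Among the monomials of \<open>h\<close> pick \<open>t\<close> with the largest exponent of the variable \<open>a\<close>.  The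
  monomial \<open>t\<close> times the variable \<open>a\<close> arises only once in the product, with coefficient 2 times
  that of \<open>t\<close>.
\<close>

lemma simple_root_mult_eq_0:
  fixes h :: "('m::nontriv, 'k::field) R"
  assumes two: "(2 :: 'k) \<noteq> 0" and 0: "simple_root a * h = 0"
  shows "h = 0"
proof (rule ccontr)
  assume "h \<noteq> 0"
  then have "Poly_Mapping.keys h \<noteq> {}"
    by simp
  then obtain t where t: "t \<in> Poly_Mapping.keys h"
    and max: "\<And>s. s \<in> Poly_Mapping.keys h \<Longrightarrow> Poly_Mapping.lookup s a \<le> Poly_Mapping.lookup t a"
    using Max_in[of "(\<lambda>s. Poly_Mapping.lookup s a) ` Poly_Mapping.keys h"]
      Max_ge[of "(\<lambda>s. Poly_Mapping.lookup s a) ` Poly_Mapping.keys h"] by fastforce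
  let ?x = "\<lambda>b :: 'm mod_ring. Poly_Mapping.single b (1 :: nat)"
  have "Poly_Mapping.lookup (Poly_Mapping.single (?x b) (cartan a b) * h) (?x a + t) =
      (if b = a then 2 * Poly_Mapping.lookup h t else 0)" for b
  proof (cases "b = a")
    case True
    have "cartan a a = (2 :: 'k)"
      by (simp add: cartan_def cox_def)
    then show ?thesis
      using True t by (simp add: lookup_single_mult when_def in_keys_iff)
  next
    case False
    have "?x b + s \<noteq> ?x a + t" if "s \<in> Poly_Mapping.keys h" for s
    proof
      assume "?x b + s = ?x a + t"
      then have "Poly_Mapping.lookup (?x b + s) a = Poly_Mapping.lookup (?x a + t) a"
        by simp
      then show False
        using False max[OF that] by (simp add: lookup_add lookup_single when_def)
    qed
    then show ?thesis
      using False by (auto simp: lookup_single_mult when_def intro!: sum.neutral)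
  qed
  then have "Poly_Mapping.lookup (simple_root a * h) (?x a + t) = 2 * Poly_Mapping.lookup h t"
    by (simp add: simple_root_def sum_distrib_right lookup_sum)
  then show False
    using 0 two t by (simp add: in_keys_iff)
qed

text \<open>The reflection moves only the variable \<open>a\<close>. The other variables form the
  common factor \<open>?Q\<close>, and the geometric sum \<open>?S\<close> is the quotient of
  \<open>var a ^ ?n - \<sigma> a ^ ?n\<close> by \<open>var a - \<sigma> a\<close>, which is the
  simple root.\<close>

lemma demazure_monomial:
  fixes t :: "'m::nontriv mod_ring \<Rightarrow>\<^sub>0 nat" and a :: "'m mod_ring"
  defines "\<sigma> \<equiv> \<lambda>b. if b = a then var b - simple_root a else (var b :: ('m, 'k::field) R)"
  shows "\<exists>g. homogeneous (2 * (\<Sum>b\<in>UNIV. Poly_Mapping.lookup t b) - 2) g \<and>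
    simple_root a * g = (\<Prod>b\<in>UNIV. var b ^ Poly_Mapping.lookup t b) -
      (\<Prod>b\<in>UNIV. \<sigma> b ^ Poly_Mapping.lookup t b)"
proof -
  let ?n = "Poly_Mapping.lookup t a"
  let ?Q = "\<Prod>b\<in>UNIV - {a}. (var b :: ('m, 'k) R) ^ Poly_Mapping.lookup t b"
  let ?S = "\<Sum>i<?n. \<sigma> a ^ (?n - Suc i) * var a ^ i"
  have "homogeneous (\<Sum>b\<in>UNIV - {a}. 2 * Poly_Mapping.lookup t b) ?Q"
    by (intro homogeneous_prod homogeneous_power homogeneous_var)
  moreover have "homogeneous (2 * ?n - 2) ?S"
  proof (rule homogeneous_sum)
    fix i assume i: "i \<in> {..<?n}"
    have "homogeneous (2 * (?n - Suc i) + 2 * i) (\<sigma> a ^ (?n - Suc i) * var a ^ i)"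
      unfolding \<sigma>_def using homogeneous_diff[OF homogeneous_var homogeneous_simple_root]
      by (intro homogeneous_mult homogeneous_power homogeneous_var) simp
    moreover have "2 * (?n - Suc i) + 2 * i = 2 * ?n - 2"
      using i by auto
    ultimately show "homogeneous (2 * ?n - 2) (\<sigma> a ^ (?n - Suc i) * var a ^ i)"
      by simp
  qed
  ultimately have hom: "homogeneous ((\<Sum>b\<in>UNIV - {a}. 2 * Poly_Mapping.lookup t b) + (2 * ?n - 2)) (?Q * ?S)"
    by (rule homogeneous_mult)
  \<comment> \<open>The truncated \<open>2 * ?n - 2\<close> adds up to the required degree only for
    \<open>?n > 0\<close>. If \<open>a\<close> does not occur in the monomial, \<open>?S\<close> is
    an empty sum and the product is zero, hence homogeneous of every degree.\<close>
  have "homogeneous (2 * (\<Sum>b\<in>UNIV. Poly_Mapping.lookup t b) - 2) (?Q * ?S)"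
  proof (cases "?n = 0")
    case False
    then have "2 * (\<Sum>b\<in>UNIV. Poly_Mapping.lookup t b) - 2 =
        (\<Sum>b\<in>UNIV - {a}. 2 * Poly_Mapping.lookup t b) + (2 * ?n - 2)"
      by (subst sum.remove[of _ a]) (simp_all add: sum_distrib_left)
    then show ?thesis
      using hom by simp
  qed simp
  moreover have "simple_root a * (?Q * ?S) = (\<Prod>b\<in>UNIV. var b ^ Poly_Mapping.lookup t b) -
      (\<Prod>b\<in>UNIV. \<sigma> b ^ Poly_Mapping.lookup t b)"
  proof -
    have \<sigma>a: "var a - \<sigma> a = simple_root a"
      by (simp add: \<sigma>_def)
    have "simple_root a * ?S = var a ^ ?n - \<sigma> a ^ ?n"
      unfolding power_diff_sumr2 by (simp only: \<sigma>a)
    then have "simple_root a * (?Q * ?S) = ?Q * var a ^ ?n - ?Q * \<sigma> a ^ ?n"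
      by (simp only: mult.left_commute[of "simple_root a"] right_diff_distrib)
    also have "?Q * \<sigma> a ^ ?n = (\<Prod>b\<in>UNIV. \<sigma> b ^ Poly_Mapping.lookup t b)"
      unfolding prod.remove[where x = a, OF finite UNIV_I]
      by (simp add: \<sigma>_def mult.commute)
    also have "?Q * var a ^ ?n = (\<Prod>b\<in>UNIV. var b ^ Poly_Mapping.lookup t b)"
      unfolding prod.remove[where x = a, OF finite UNIV_I] by (rule mult.commute)
    finally show ?thesis .
  qed
  ultimately show ?thesis
    by blast
qed

text \<open>The description by \<open>THE\<close> is met by the explicit quotient \<open>g\<close>,
  assembled from the monomial quotients, and by nothing else since the simple root is not a zero
  divisor. The truncation of \<open>d - 2\<close> is harmless: the Demazure operator kills
  constants.\<close>

lemma homogeneous_demazure: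
  fixes f :: "('m::nontriv, 'k::field) R"
  assumes two: "(2 :: 'k) \<noteq> 0" and "homogeneous d f"
  shows "homogeneous (d - 2) (demazure a f)"
proof -
  define \<sigma> where "\<sigma> = (\<lambda>b. if b = a then var b - simple_root a else (var b :: ('m, 'k) R))"
  have "\<exists>G. \<forall>t. homogeneous (2 * (\<Sum>b\<in>UNIV. Poly_Mapping.lookup t b) - 2) (G t) \<and>
    simple_root a * G t = (\<Prod>b\<in>UNIV. var b ^ Poly_Mapping.lookup t b) -
      (\<Prod>b\<in>UNIV. \<sigma> b ^ Poly_Mapping.lookup t b)"
    unfolding \<sigma>_def by (intro choice allI demazure_monomial)
  then obtain G where G: "homogeneous (2 * (\<Sum>b\<in>UNIV. Poly_Mapping.lookup t b) - 2) (G t)"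
    "simple_root a * G t = (\<Prod>b\<in>UNIV. var b ^ Poly_Mapping.lookup t b) -
      (\<Prod>b\<in>UNIV. \<sigma> b ^ Poly_Mapping.lookup t b)" for t
    by blast
  define g where "g = (\<Sum>t\<in>Poly_Mapping.keys f. Poly_Mapping.single 0 (Poly_Mapping.lookup f t) * G t)"
  have "homogeneous (d - 2) g"
    unfolding g_def
  proof (rule homogeneous_sum)
    fix t assume "t \<in> Poly_Mapping.keys f"
    then have d: "d - 2 = 0 + (2 * (\<Sum>b\<in>UNIV. Poly_Mapping.lookup t b) - 2)"
      using assms(2) by (simp add: homogeneous_def)
    show "homogeneous (d - 2) (Poly_Mapping.single 0 (Poly_Mapping.lookup f t) * G t)"
      unfolding d by (intro homogeneous_mult homogeneous_const G)
  qed
  moreover have g: "simple_root a * g = f - refl_act a f"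
  proof -
    have "simple_root a * g = poly_subst var f - poly_subst \<sigma> f"
      unfolding g_def poly_subst_def sum_distrib_left mult.left_commute[of "simple_root a"] G(2)
        right_diff_distrib sum_subtractf ..
    then show ?thesis
      by (simp add: poly_subst_var refl_act_def \<sigma>_def)
  qed
  moreover have "demazure a f = g"
    unfolding demazure_def
  proof (rule the_equality)
    fix g' assume "simple_root a * g' = f - refl_act a f"
    then have "simple_root a * (g' - g) = 0"
      using g by (simp add: right_diff_distrib)
    then show "g' = g"
      using simple_root_mult_eq_0[OF two, of a "g' - g"] by simp
  qed (fact g)
  ultimately show ?thesis
    by simp
qed


section \<open>The local relations relate morphisms with the same boundary\<close>

lemma cox_commute: "cox a b = cox b a"
  by (auto simp: cox_def)

text \<open>Rotation and associativity are stated with alternating words of length \<open>n\<close>;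
  only two lengths remain, and on these explicit words boundaries can be computed.\<close>

lemma cox_cases: "a \<noteq> b \<Longrightarrow> cox a b \<noteq> 0 \<Longrightarrow> cox a b = 2 \<or> cox a b = 3"
  by (auto simp: cox_def)

lemma cox_self [simp]: "cox a a = 1"
  by (simp add: cox_def)

lemma alt_2: "alt a b 2 = [a, b]"
  by (simp add: numeral_2_eq_2)

lemma alt_3: "alt a b 3 = [a, b, a]"
  by (simp add: numeral_3_eq_3)

lemma local_rel_free_hom:
  fixes x y :: "('m::nontriv, 'k::field) mor"
  assumes two: "(2 :: 'k) \<noteq> 0" and "local_rel d e x y"
  shows "x \<in> free_hom d e \<and> y \<in> free_hom d e"
  using assms(2)
proof cases
  case (rotate_vertex a b n z)
  then show ?thesis
    using cox_cases[of a b] cox_commute[of a b] by (auto simp: alt_2 alt_3)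
next
  case (two_color_assoc a b n z)
  then show ?thesis
    using cox_cases[of a b] cox_commute[of a b] by (auto simp: alt_2 alt_3 numeral_2_eq_2)
next
  case (box_add d f g)
  then show ?thesis
    using homogeneous_add[of d f g] by (auto intro!: free_hom_add)
next
  case (box_scal d f c)
  then show ?thesis
    using homogeneous_scal[of d f c] by auto
next
  case (box_mult d f e g)
  then show ?thesis
    using homogeneous_mult[of d f e g] by auto
next
  case box_one
  then show ?thesis
    by (auto intro: homogeneous_one)
next
  case (barbell a)
  then show ?thesis
    using homogeneous_simple_root by auto
next
  case (forcing d f a)
  then show ?thesis
    using homogeneous_refl_act[of d f a] homogeneous_demazure[OF two, of d f a] by (auto intro!: free_hom_add)
next
  case (jones_wenzl_2 a b)
  then show ?thesis
    by (auto simp: alt_2)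
next
  case (jones_wenzl_3 a b)
  then show ?thesis
    by (auto intro!: free_hom_add simp: alt_3)
next
  case (zamolodchikov_A1_A1_A1 a b c)
  then show ?thesis
    by (auto simp: alt_2)
next
  case (zamolodchikov_A2_A1 a b c)
  then show ?thesis
    by (auto simp: alt_2 alt_3)
next
  case (zamolodchikov_A3 a b c)
  then show ?thesis
    using cox_commute[of a c] by (auto simp: alt_2 alt_3)
qed auto

lemma null_hom_subset_free_hom:
  assumes "(2 :: 'k) \<noteq> 0"
  shows "null_hom u v \<subseteq> (free_hom u v :: ('m::nontriv, 'k::field) mor set)"
proof
  fix n :: "('m, 'k) mor" assume "n \<in> null_hom u v"
  then show "n \<in> free_hom u v"
  proof (induction n rule: null_hom_induct)
    case (local p l r q x y d e)
    then show ?case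
      using local_rel_free_hom[OF assms local(3)] by (intro in_context_free_hom) auto
  next
    case (annihilation p f w q d)
    then show ?case
      by (auto simp: soergel_graph_append)
  qed auto
qed


section \<open>Diagrammatic calculus\<close>

text \<open>The congruence generated by those relations that have a single graph on each side.
  Equational chains can then be written with graphs instead of differences lying in
  \<open>null_hom\<close>. The boundaries are recorded because a window may only be replaced in a
  composable graph.\<close>

inductive graph_eq :: "'m::nontriv expr \<Rightarrow> 'm expr \<Rightarrow> ('m, 'k::field) graph \<Rightarrow> ('m, 'k) graph \<Rightarrow> bool" where
  local: "local_rel d e (gr s) (gr t) \<Longrightarrow> soergel_graph u p (l @ d @ r) \<Longrightarrow> soergel_graph (l @ e @ r) q v \<Longrightarrow>
    graph_eq u v (p @ whisker l r s @ q) (p @ whisker l r t @ q)"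
| refl: "graph_eq u v p p"
| sym: "graph_eq u v p q \<Longrightarrow> graph_eq u v q p"
| trans: "graph_eq u v p q \<Longrightarrow> graph_eq u v q s \<Longrightarrow> graph_eq u v p s"

lemmas [trans] = graph_eq.trans

lemma whisker_simps [simp]:
  "whisker x y [] = []"
  "whisker x y ((l, g, r) # p) = (x @ l, g, r @ y) # whisker x y p"
  by (simp_all add: whisker_def)

lemma whisker_Nil: "whisker [] [] p = p"
  by (simp add: whisker_def case_prod_beta')

lemma whisker_append: "whisker x y (p @ q) = whisker x y p @ whisker x y q"
  by (simp add: whisker_def)

lemma whisker_whisker: "whisker x y (whisker l r p) = whisker (x @ l) (r @ y) p"
  by (simp add: whisker_def case_prod_beta')

lemma graph_eq_local_rel: "local_rel d e (gr s) (gr t) \<Longrightarrow> graph_eq d e s t"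
  using graph_eq.local[of d e s t d "[]" "[]" "[]" "[]" e] by (simp add: whisker_Nil)

text \<open>A window inside a window is again a window, so derived equalities can be applied exactly
  like the original relations. In the chains of moves, the instantiation gives in turn the bottom
  boundary, the graph below, the strands at the left and right, the graph above and the top
  boundary.\<close>

lemma graph_eq_in_context:
  assumes "graph_eq d e s t" "soergel_graph u p (l @ d @ r)" "soergel_graph (l @ e @ r) q v"
  shows "graph_eq u v (p @ whisker l r s @ q) (p @ whisker l r t @ q)"
  using assms
proof (induction arbitrary: u v p q rule: graph_eq.induct)
  case (local d' e' s t d p' l' r' q' e)
  have "soergel_graph u (p @ whisker l r p') ((l @ l') @ d' @ r' @ r)"
    using local soergel_graph_whisker[of d p' "l' @ d' @ r'" l r] by (auto simp: soergel_graph_append)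
  moreover have "soergel_graph ((l @ l') @ e' @ r' @ r) (whisker l r q' @ q) v"
    using local soergel_graph_whisker[of "l' @ e' @ r'" q' e l r] by (auto simp: soergel_graph_append)
  ultimately show ?case
    using graph_eq.local[OF local(1), of u "p @ whisker l r p'" "l @ l'" "r' @ r" "whisker l r q' @ q" v]
    by (simp add: whisker_append whisker_whisker)
qed (blast intro: graph_eq.intros)+

lemma graph_eq_null_hom: "graph_eq u v p q \<Longrightarrow> gr p - gr q \<in> null_hom u v"
proof (induction rule: graph_eq.induct)
  case (local d e s t u p l r q v)
  from null_hom_local[OF local(2,3,1)] show ?case
    by (simp add: in_context_diff)
next
  case (sym u v p q)
  from null_hom_uminus[OF sym.IH] show ?case
    by simp
next
  case (trans u v p q s)
  from null_hom_add[OF trans.IH] show ?case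
    by simp
qed simp

lemmas graph_eq_interchange = graph_eq_local_rel[OF local_rel.interchange]

text \<open>The relations rotate a dot through a cap only. To pass a cup, the end dot is written as
  a start dot under a cap, the start dot is pulled below the cup, and the remaining zigzag is
  straightened.\<close>

lemma cup_end_dot_left:
  "graph_eq [] [a] [([], Cup a, []), ([], EndDot a, [a])] [([], StartDot a, [])]"
proof -
  have "graph_eq [] [a] [([], Cup a, []), ([], EndDot a, [a])]
      [([], Cup a, []), ([], StartDot a, [a, a]), ([], Cap a, [a])]"
    using graph_eq_in_context[OF graph_eq_local_rel[OF local_rel.rotate_dot_left, THEN graph_eq.sym],
        of "[]" "[([], Cup a, [])]" "[]" a "[a]" "[]" "[a]"] by simp
  also have "graph_eq [] [a] \<dots> [([], StartDot a, []), ([a], Cup a, []), ([], Cap a, [a])]"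
    using graph_eq_in_context[OF graph_eq_interchange[of "StartDot a" "Cup a" "[]", THEN graph_eq.sym],
        of "[]" "[]" "[]" "[]" "[([], Cap a, [a])]" "[a]"] by simp
  also have "graph_eq [] [a] \<dots> [([], StartDot a, [])]"
    using graph_eq_in_context[OF graph_eq_local_rel[OF local_rel.zigzag_right],
        of "[]" "[([], StartDot a, [])]" "[]" a "[]" "[]" "[a]"] by simp
  finally show ?thesis .
qed

lemma cup_end_dot_right:
  "graph_eq [] [a] [([], Cup a, []), ([a], EndDot a, [])] [([], StartDot a, [])]"
proof -
  have "graph_eq [] [a] [([], Cup a, []), ([a], EndDot a, [])]
      [([], Cup a, []), ([a, a], StartDot a, []), ([a], Cap a, [])]"
    using graph_eq_in_context[OF graph_eq_local_rel[OF local_rel.rotate_dot_right, THEN graph_eq.sym],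
        of "[]" "[([], Cup a, [])]" "[a]" a "[]" "[]" "[a]"] by simp
  also have "graph_eq [] [a] \<dots> [([], StartDot a, []), ([], Cup a, [a]), ([a], Cap a, [])]"
    using graph_eq_in_context[OF graph_eq_interchange[of "Cup a" "StartDot a" "[]"],
        of "[]" "[]" "[]" "[]" "[([a], Cap a, [])]" "[a]"] by simp
  also have "graph_eq [] [a] \<dots> [([], StartDot a, [])]"
    using graph_eq_in_context[OF graph_eq_local_rel[OF local_rel.zigzag_left],
        of "[]" "[([], StartDot a, [])]" "[]" a "[]" "[]" "[a]"] by simp
  finally show ?thesis .
qed

text \<open>The unit law is imposed for merges. Writing the split as a merge with one leg bent by a
  cup turns the upper dot into a start dot, where that law applies.\<close>

lemma split_end_dot_right:
  "graph_eq [a] [a] [([], Split a, []), ([a], EndDot a, [])] []"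
proof -
  have "graph_eq [a] [a] [([], Split a, []), ([a], EndDot a, [])]
      [([a], Cup a, []), ([], Merge a, [a]), ([a], EndDot a, [])]"
    using graph_eq_in_context[OF graph_eq_local_rel[OF local_rel.rotate_trivalent_right, THEN graph_eq.sym],
        of "[a]" "[]" "[]" a "[]" "[([a], EndDot a, [])]" "[a]"] by simp
  also have "graph_eq [a] [a] \<dots> [([a], Cup a, []), ([a, a], EndDot a, []), ([], Merge a, [])]"
    using graph_eq_in_context[OF graph_eq_interchange[of "Merge a" "EndDot a" "[]"],
        of "[a]" "[([a], Cup a, [])]" "[]" "[]" "[]" "[a]"] by simp
  also have "graph_eq [a] [a] \<dots> [([a], StartDot a, []), ([], Merge a, [])]"
    using graph_eq_in_context[OF cup_end_dot_right,
        of "[a]" "[]" "[a]" "[]" a "[([], Merge a, [])]" "[a]"] by simp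
  also have "graph_eq [a] [a] \<dots> []"
    by (rule graph_eq_local_rel[OF local_rel.unit_right])
  finally show ?thesis .
qed

lemma merge_eq_split_cap:
  "graph_eq [a, a] [a] [([], Merge a, [])] [([a], Split a, []), ([], Cap a, [a])]"
proof -
  have "graph_eq [a, a] [a] [([a], Split a, []), ([], Cap a, [a])]
      [([a], Cup a, [a]), ([a, a], Merge a, []), ([], Cap a, [a])]"
    using graph_eq_in_context[OF graph_eq_local_rel[OF local_rel.rotate_trivalent_left, THEN graph_eq.sym],
        of "[a, a]" "[]" "[a]" a "[]" "[([], Cap a, [a])]" "[a]"] by simp
  also have "graph_eq [a, a] [a] \<dots> [([a], Cup a, [a]), ([], Cap a, [a, a]), ([], Merge a, [])]"
    using graph_eq_in_context[OF graph_eq_interchange[of "Cap a" "Merge a" "[]", THEN graph_eq.sym],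
        of "[a, a]" "[([a], Cup a, [a])]" "[]" "[]" "[]" "[a]"] by simp
  also have "graph_eq [a, a] [a] \<dots> [([], Merge a, [])]"
    using graph_eq_in_context[OF graph_eq_local_rel[OF local_rel.zigzag_right],
        of "[a, a]" "[]" "[]" a "[a]" "[([], Merge a, [])]" "[a]"] by simp
  finally show ?thesis
    by (rule graph_eq.sym)
qed

text \<open>Allows a cap to be traded for a merge, the only trivalent vertex in two-color
  associativity.\<close>

lemma merge_end_dot:
  "graph_eq [a, a] [] [([], Merge a, []), ([], EndDot a, [])] [([], Cap a, [])]"
proof -
  have "graph_eq [a, a] [] [([], Merge a, []), ([], EndDot a, [])]
      [([a], Split a, []), ([], Cap a, [a]), ([], EndDot a, [])]"
    using graph_eq_in_context[OF merge_eq_split_cap,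
        of "[a, a]" "[]" "[]" a "[]" "[([], EndDot a, [])]" "[]"] by simp
  also have "graph_eq [a, a] [] \<dots> [([a], Split a, []), ([a, a], EndDot a, []), ([], Cap a, [])]"
    using graph_eq_in_context[OF graph_eq_interchange[of "Cap a" "EndDot a" "[]"],
        of "[a, a]" "[([a], Split a, [])]" "[]" "[]" "[]" "[]"] by simp
  also have "graph_eq [a, a] [] \<dots> [([], Cap a, [])]"
    using graph_eq_in_context[OF split_end_dot_right,
        of "[a, a]" "[]" "[a]" a "[]" "[([], Cap a, [])]" "[]"] by simp
  finally show ?thesis .
qed

section \<open>Dots on a crossing of two commuting colors\<close>

context
  fixes a b :: "'m::nontriv mod_ring"
  assumes ab: "cox a b = 2"
begin

lemma cox_simps: "cox a b = 2" "cox b a = 2" "a \<noteq> b" "b \<noteq> a"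
  using ab cox_commute[of a b] by (auto simp: cox_def)

text \<open>Trades a crossing for the opposite one, which makes the start-dot relation available at
  other legs.\<close>

lemma rotate_crossing:
  "graph_eq [b, a] [a, b] [([], Vertex b a, [])]
    [([], Cup a, [b, a]), ([a], Vertex a b, [a]), ([a, b], Cap a, [])]"
  using graph_eq_local_rel[OF local_rel.rotate_vertex[of a b 2 a], THEN graph_eq.sym]
  by (simp add: alt_2 cox_simps)

lemma crossing_start_dot_left:
  "graph_eq [b] [b, a] [([], StartDot a, [b]), ([], Vertex a b, [])] [([b], StartDot a, [])]"
  by (rule graph_eq_local_rel[OF local_rel.jones_wenzl_2[OF ab]])

text \<open>After rotation the dot slides down past the crossing to the cup and becomes a start dot
  on its lower left leg. The start-dot relation removes the crossing, and the leftover cap turns the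
  dot back into an end dot.\<close>

lemma crossing_end_dot_left:
  "graph_eq [b, a] [b] [([], Vertex b a, []), ([], EndDot a, [b])] [([b], EndDot a, [])]"
proof -
  note [simp] = cox_simps alt_2
  have "graph_eq [b, a] [b] [([], Vertex b a, []), ([], EndDot a, [b])]
      [([], Cup a, [b, a]), ([a], Vertex a b, [a]), ([a, b], Cap a, []), ([], EndDot a, [b])]"
    using graph_eq_in_context[OF rotate_crossing,
        of "[b, a]" "[]" "[]" "[]" "[([], EndDot a, [b])]" "[b]"] by simp
  also have "graph_eq [b, a] [b] \<dots>
      [([], Cup a, [b, a]), ([a], Vertex a b, [a]), ([], EndDot a, [b, a, a]), ([b], Cap a, [])]"
    using graph_eq_in_context[OF graph_eq_interchange[of "EndDot a" "Cap a" "[b]", THEN graph_eq.sym],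
        of "[b, a]" "[([], Cup a, [b, a]), ([a], Vertex a b, [a])]" "[]" "[]" "[]" "[b]"] by simp
  also have "graph_eq [b, a] [b] \<dots>
      [([], Cup a, [b, a]), ([], EndDot a, [a, b, a]), ([], Vertex a b, [a]), ([b], Cap a, [])]"
    using graph_eq_in_context[OF graph_eq_interchange[of "EndDot a" "Vertex a b" "[]", THEN graph_eq.sym],
        of "[b, a]" "[([], Cup a, [b, a])]" "[]" "[a]" "[([b], Cap a, [])]" "[b]"] by simp
  also have "graph_eq [b, a] [b] \<dots>
      [([], StartDot a, [b, a]), ([], Vertex a b, [a]), ([b], Cap a, [])]"
    using graph_eq_in_context[OF cup_end_dot_left,
        of "[b, a]" "[]" "[]" "[b, a]" a "[([], Vertex a b, [a]), ([b], Cap a, [])]" "[b]"] by simp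
  also have "graph_eq [b, a] [b] \<dots> [([b], StartDot a, [a]), ([b], Cap a, [])]"
    using graph_eq_in_context[OF crossing_start_dot_left,
        of "[b, a]" "[]" "[]" "[a]" "[([b], Cap a, [])]" "[b]"] by simp
  also have "graph_eq [b, a] [b] \<dots> [([b], EndDot a, [])]"
    using graph_eq_in_context[OF graph_eq_local_rel[OF local_rel.rotate_dot_left],
        of "[b, a]" "[]" "[b]" a "[]" "[]" "[b]"] by simp
  finally show ?thesis .
qed

end

text \<open>Rotating along the other color \<open>b\<close> puts the dotted leg at the upper left,
  the case already settled; a zigzag of color \<open>b\<close> remains to be straightened.\<close>

lemma crossing_end_dot_right:
  assumes ab: "cox a b = 2"
  shows "graph_eq [a, b] [b] [([], Vertex a b, []), ([b], EndDot a, [])] [([], EndDot a, [b])]"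
proof -
  note [simp] = cox_simps[OF ab] alt_2
  have "graph_eq [a, b] [b] [([], Vertex a b, []), ([b], EndDot a, [])]
      [([], Cup b, [a, b]), ([b], Vertex b a, [b]), ([b, a], Cap b, []), ([b], EndDot a, [])]"
    using graph_eq_in_context[OF rotate_crossing[of b a],
        of "[a, b]" "[]" "[]" "[]" "[([b], EndDot a, [])]" "[b]"] by simp
  also have "graph_eq [a, b] [b] \<dots>
      [([], Cup b, [a, b]), ([b], Vertex b a, [b]), ([b], EndDot a, [b, b]), ([b], Cap b, [])]"
    using graph_eq_in_context[OF graph_eq_interchange[of "EndDot a" "Cap b" "[]", THEN graph_eq.sym],
        of "[a, b]" "[([], Cup b, [a, b]), ([b], Vertex b a, [b])]" "[b]" "[]" "[]" "[b]"] by simp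
  also have "graph_eq [a, b] [b] \<dots> [([], Cup b, [a, b]), ([b, b], EndDot a, [b]), ([b], Cap b, [])]"
    using graph_eq_in_context[OF crossing_end_dot_left[OF ab],
        of "[a, b]" "[([], Cup b, [a, b])]" "[b]" "[b]" "[([b], Cap b, [])]" "[b]"] by simp
  also have "graph_eq [a, b] [b] \<dots> [([], EndDot a, [b]), ([], Cup b, [b]), ([b], Cap b, [])]"
    using graph_eq_in_context[OF graph_eq_interchange[of "Cup b" "EndDot a" "[]"],
        of "[a, b]" "[]" "[]" "[b]" "[([b], Cap b, [])]" "[b]"] by simp
  also have "graph_eq [a, b] [b] \<dots> [([], EndDot a, [b])]"
    using graph_eq_in_context[OF graph_eq_local_rel[OF local_rel.zigzag_left],
        of "[a, b]" "[([], EndDot a, [b])]" "[]" b "[]" "[]" "[b]"] by simp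
  finally show ?thesis .
qed

text \<open>
  Rotating the upper crossing produces two crossings of one \<open>b\<close>-strand with the two legs of an
  \<open>a\<close>-colored cap.  Writing the cap as a dotted trivalent vertex, two-color associativity merges
  them into one crossing, which the dot removes.
\<close>

lemma crossing_crossing:
  assumes ab: "cox a b = 2"
  shows "graph_eq [a, b] [a, b] [([], Vertex a b, []), ([], Vertex b a, [])] []"
proof -
  note [simp] = cox_simps[OF ab] alt_2
  have assoc: "graph_eq [a, a, b] [b, a]
      [([a], Vertex a b, []), ([], Vertex a b, [a]), ([b], Merge a, [])]
      [([], Merge a, [b]), ([], Vertex a b, [])]"
    using graph_eq_local_rel[OF local_rel.two_color_assoc[of a b 2 a], THEN graph_eq.sym] by simp
  have "graph_eq [a, b] [a, b] [([], Vertex a b, []), ([], Vertex b a, [])]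
      [([], Vertex a b, []), ([], Cup a, [b, a]), ([a], Vertex a b, [a]), ([a, b], Cap a, [])]"
    using graph_eq_in_context[OF rotate_crossing[OF ab],
        of "[a, b]" "[([], Vertex a b, [])]" "[]" "[]" "[]" "[a, b]"] by simp
  also have "graph_eq [a, b] [a, b] \<dots>
      [([], Cup a, [a, b]), ([a, a], Vertex a b, []), ([a], Vertex a b, [a]), ([a, b], Cap a, [])]"
    using graph_eq_in_context[OF graph_eq_interchange[of "Cup a" "Vertex a b" "[]", THEN graph_eq.sym],
        of "[a, b]" "[]" "[]" "[]" "[([a], Vertex a b, [a]), ([a, b], Cap a, [])]" "[a, b]"] by simp
  also have "graph_eq [a, b] [a, b] \<dots>
      [([], Cup a, [a, b]), ([a, a], Vertex a b, []), ([a], Vertex a b, [a]),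
       ([a, b], Merge a, []), ([a, b], EndDot a, [])]"
    using graph_eq_in_context[OF merge_end_dot[THEN graph_eq.sym], of "[a, b]"
        "[([], Cup a, [a, b]), ([a, a], Vertex a b, []), ([a], Vertex a b, [a])]"
        "[a, b]" a "[]" "[]" "[a, b]"] by simp
  also have "graph_eq [a, b] [a, b] \<dots>
      [([], Cup a, [a, b]), ([a], Merge a, [b]), ([a], Vertex a b, []), ([a, b], EndDot a, [])]"
    using graph_eq_in_context[OF assoc, of "[a, b]" "[([], Cup a, [a, b])]" "[a]" "[]"
        "[([a, b], EndDot a, [])]" "[a, b]"] by simp
  also have "graph_eq [a, b] [a, b] \<dots>
      [([], Cup a, [a, b]), ([a], Merge a, [b]), ([a], EndDot a, [b])]"
    using graph_eq_in_context[OF crossing_end_dot_right[OF ab],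
        of "[a, b]" "[([], Cup a, [a, b]), ([a], Merge a, [b])]" "[a]" "[]" "[]" "[a, b]"] by simp
  also have "graph_eq [a, b] [a, b] \<dots> [([], Split a, [b]), ([a], EndDot a, [b])]"
    using graph_eq_in_context[OF graph_eq_local_rel[OF local_rel.rotate_trivalent_left],
        of "[a, b]" "[]" "[]" a "[b]" "[([a], EndDot a, [b])]" "[a, b]"] by simp
  also have "graph_eq [a, b] [a, b] \<dots> []"
    using graph_eq_in_context[OF split_end_dot_right,
        of "[a, b]" "[]" "[]" a "[b]" "[]" "[a, b]"] by simp
  finally show ?thesis .
qed

text \<open>The start-dot relation read backwards moves the dot to the left at the price of an
  opposite crossing, which cancels against the given one.\<close>

lemma crossing_start_dot_right:
  assumes ab: "cox a b = 2"
  shows "graph_eq [a] [b, a] [([a], StartDot b, []), ([], Vertex a b, [])] [([], StartDot b, [a])]"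
proof -
  note [simp] = cox_simps[OF ab] alt_2
  have "graph_eq [a] [b, a] [([a], StartDot b, []), ([], Vertex a b, [])]
      [([], StartDot b, [a]), ([], Vertex b a, []), ([], Vertex a b, [])]"
    using graph_eq_in_context[OF crossing_start_dot_left[of b a, THEN graph_eq.sym],
        of "[a]" "[]" "[]" "[]" "[([], Vertex a b, [])]" "[b, a]"] by simp
  also have "graph_eq [a] [b, a] \<dots> [([], StartDot b, [a])]"
    using graph_eq_in_context[OF crossing_crossing[of b a],
        of "[a]" "[([], StartDot b, [a])]" "[]" "[]" "[]" "[b, a]"] by simp
  finally show ?thesis .
qed


section \<open>Conjugating broken strands by a crossing\<close>

context
  fixes b c :: "'m::nontriv mod_ring"
  assumes bc: "cox b c = 2"
begin

text \<open>The end dot absorbs the lower crossing and the start dot the upper one, leaving the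
  broken strand on the other side of \<open>c\<close>.\<close>

lemma conj_broken_first:
  "graph_eq [c, b] [c, b]
    [([], Vertex c b, []), ([], EndDot b, [c]), ([], StartDot b, [c]), ([], Vertex b c, [])]
    [([c], EndDot b, []), ([c], StartDot b, [])]"
proof -
  note [simp] = cox_simps[OF bc] alt_2
  have "graph_eq [c, b] [c, b]
      [([], Vertex c b, []), ([], EndDot b, [c]), ([], StartDot b, [c]), ([], Vertex b c, [])]
      [([c], EndDot b, []), ([], StartDot b, [c]), ([], Vertex b c, [])]"
    using graph_eq_in_context[OF crossing_end_dot_left[OF bc], of "[c, b]" "[]" "[]" "[]"
        "[([], StartDot b, [c]), ([], Vertex b c, [])]" "[c, b]"] by simp
  also have "graph_eq [c, b] [c, b] \<dots> [([c], EndDot b, []), ([c], StartDot b, [])]"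
    using graph_eq_in_context[OF crossing_start_dot_left[OF bc],
        of "[c, b]" "[([c], EndDot b, [])]" "[]" "[]" "[]" "[c, b]"] by simp
  finally show ?thesis .
qed

lemma conj_broken_second:
  "graph_eq [c, b] [c, b]
    [([], Vertex c b, []), ([b], EndDot c, []), ([b], StartDot c, []), ([], Vertex b c, [])]
    [([], EndDot c, [b]), ([], StartDot c, [b])]"
proof -
  note [simp] = cox_simps[OF bc] alt_2
  have "graph_eq [c, b] [c, b]
      [([], Vertex c b, []), ([b], EndDot c, []), ([b], StartDot c, []), ([], Vertex b c, [])]
      [([], EndDot c, [b]), ([b], StartDot c, []), ([], Vertex b c, [])]"
    using graph_eq_in_context[OF crossing_end_dot_right[of c b], of "[c, b]" "[]" "[]" "[]"
        "[([b], StartDot c, []), ([], Vertex b c, [])]" "[c, b]"] by simp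
  also have "graph_eq [c, b] [c, b] \<dots> [([], EndDot c, [b]), ([], StartDot c, [b])]"
    using graph_eq_in_context[OF crossing_start_dot_right[OF bc],
        of "[c, b]" "[([], EndDot c, [b])]" "[]" "[]" "[]" "[c, b]"] by simp
  finally show ?thesis .
qed

text \<open>The lower crossing slides up past both distant dots until it meets the upper one and
  cancels. The window ends exactly at the broken strand and at the crossing, the shape required by
  \<open>interchange\<close>.\<close>

lemma conj_broken_left:
  "graph_eq (a # w @ [c, b]) (a # w @ [c, b])
    [(a # w, Vertex c b, []), ([], EndDot a, w @ [b, c]), ([], StartDot a, w @ [b, c]),
     (a # w, Vertex b c, [])]
    [([], EndDot a, w @ [c, b]), ([], StartDot a, w @ [c, b])]"
proof -
  note [simp] = cox_simps[OF bc] alt_2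
  let ?u = "a # w @ [c, b]"
  have "graph_eq ?u ?u
      [(a # w, Vertex c b, []), ([], EndDot a, w @ [b, c]), ([], StartDot a, w @ [b, c]),
       (a # w, Vertex b c, [])]
      [([], EndDot a, w @ [c, b]), (w, Vertex c b, []), ([], StartDot a, w @ [b, c]),
       (a # w, Vertex b c, [])]"
    using graph_eq_in_context[OF graph_eq_interchange[of "EndDot a" "Vertex c b" w, THEN graph_eq.sym],
        of ?u "[]" "[]" "[]" "[([], StartDot a, w @ [b, c]), (a # w, Vertex b c, [])]" ?u] by simp
  also have "graph_eq ?u ?u \<dots>
      [([], EndDot a, w @ [c, b]), ([], StartDot a, w @ [c, b]), (a # w, Vertex c b, []),
       (a # w, Vertex b c, [])]"
    using graph_eq_in_context[OF graph_eq_interchange[of "StartDot a" "Vertex c b" w, THEN graph_eq.sym],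
        of ?u "[([], EndDot a, w @ [c, b])]" "[]" "[]" "[(a # w, Vertex b c, [])]" ?u] by simp
  also have "graph_eq ?u ?u \<dots> [([], EndDot a, w @ [c, b]), ([], StartDot a, w @ [c, b])]"
    using graph_eq_in_context[OF crossing_crossing[of c b],
        of ?u "[([], EndDot a, w @ [c, b]), ([], StartDot a, w @ [c, b])]" "a # w" "[]" "[]" ?u] by simp
  finally show ?thesis .
qed

lemma conj_broken_right:
  "graph_eq (c # b # w @ [a]) (c # b # w @ [a])
    [([], Vertex c b, w @ [a]), (b # c # w, EndDot a, []), (b # c # w, StartDot a, []),
     ([], Vertex b c, w @ [a])]
    [(c # b # w, EndDot a, []), (c # b # w, StartDot a, [])]"
proof -
  note [simp] = cox_simps[OF bc] alt_2
  let ?u = "c # b # w @ [a]"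
  have "graph_eq ?u ?u
      [([], Vertex c b, w @ [a]), (b # c # w, EndDot a, []), (b # c # w, StartDot a, []),
       ([], Vertex b c, w @ [a])]
      [(c # b # w, EndDot a, []), ([], Vertex c b, w), (b # c # w, StartDot a, []),
       ([], Vertex b c, w @ [a])]"
    using graph_eq_in_context[OF graph_eq_interchange[of "Vertex c b" "EndDot a" w],
        of ?u "[]" "[]" "[]" "[(b # c # w, StartDot a, []), ([], Vertex b c, w @ [a])]" ?u] by simp
  also have "graph_eq ?u ?u \<dots>
      [(c # b # w, EndDot a, []), (c # b # w, StartDot a, []), ([], Vertex c b, w @ [a]),
       ([], Vertex b c, w @ [a])]"
    using graph_eq_in_context[OF graph_eq_interchange[of "Vertex c b" "StartDot a" w],
        of ?u "[(c # b # w, EndDot a, [])]" "[]" "[]" "[([], Vertex b c, w @ [a])]" ?u] by simp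
  also have "graph_eq ?u ?u \<dots> [(c # b # w, EndDot a, []), (c # b # w, StartDot a, [])]"
    using graph_eq_in_context[OF crossing_crossing[of c b],
        of ?u "[(c # b # w, EndDot a, []), (c # b # w, StartDot a, [])]" "[]" "w @ [a]" "[]" ?u] by simp
  finally show ?thesis .
qed

text \<open>The witness \<open>k'\<close> is the image of \<open>k\<close> under the transposition
  of the two crossing strands.\<close>

lemma conj_broken:
  assumes "k < length (x @ [b, c] @ y)"
  shows "\<exists>k' < length (x @ [c, b] @ y). graph_eq (x @ [c, b] @ y) (x @ [c, b] @ y)
    ([(x, Vertex c b, y)] @ broken (x @ [b, c] @ y) k @ [(x, Vertex b c, y)])
    (broken (x @ [c, b] @ y) k')"
proof -
  note [simp] = broken_def nth_append
  consider (left) "k < length x" | (first) "k = length x" | (second) "k = Suc (length x)"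
    | (right) "Suc (length x) < k"
    by linarith
  then show ?thesis
  proof cases
    case left
    then obtain x1 a x2 where x: "x = x1 @ a # x2" and k: "k = length x1"
      using id_take_nth_drop[of k x] by (metis length_take min.absorb4)
    show ?thesis
      using graph_eq_in_context[OF conj_broken_left[of a x2], of "x @ [c, b] @ y" "[]" x1 y "[]"
          "x @ [c, b] @ y"]
      unfolding x k by (intro exI[of _ "length x1"]) simp
  next
    case first
    show ?thesis
      using graph_eq_in_context[OF conj_broken_first, of "x @ [c, b] @ y" "[]" x y "[]" "x @ [c, b] @ y"]
      unfolding first by (intro exI[of _ "Suc (length x)"]) simp
  next
    case second
    show ?thesis
      using graph_eq_in_context[OF conj_broken_second, of "x @ [c, b] @ y" "[]" x y "[]" "x @ [c, b] @ y"]
      unfolding second by (intro exI[of _ "length x"]) simp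
  next
    case right
    define j where "j = k - Suc (Suc (length x))"
    have "j < length y"
      using right assms by (simp add: j_def)
    then obtain y1 a y2 where y: "y = y1 @ a # y2" and j: "j = length y1"
      using id_take_nth_drop[of j y] by (metis length_take min.absorb4)
    have k: "k = length x + Suc (Suc (length y1))"
      using right j by (simp add: j_def)
    show ?thesis
      using graph_eq_in_context[OF conj_broken_right[of y1 a], of "x @ [c, b] @ y" "[]" x y2 "[]"
          "x @ [c, b] @ y"]
      unfolding y k by (intro exI[of _ "length x + Suc (Suc (length y1))"]) (simp add: numeral_3_eq_3)
  qed
qed

end


section \<open>The endomorphism algebras\<close>

text \<open>Classes are formed even for combinations of ill-formed graphs, so \<open>mem_cls\<close>
  and \<open>cls_eq_iff\<close> carry no side conditions.\<close>

definition cls :: "'m::nontriv expr \<Rightarrow> ('m, 'k::field) mor \<Rightarrow> ('m, 'k) mor set" where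
  "cls u f = null_hom u u +>\<^bsub>free_End u\<^esub> f"

lemma mem_cls: "g \<in> cls u f \<longleftrightarrow> g - f \<in> null_hom u u"
proof -
  have "g \<in> cls u f \<longleftrightarrow> (\<exists>n\<in>null_hom u u. g = n + f)"
    by (auto simp: cls_def a_r_coset_def' free_End_def)
  also have "\<dots> \<longleftrightarrow> g - f \<in> null_hom u u"
    by (auto intro: bexI[of _ "g - f"])
  finally show ?thesis .
qed

lemma cls_eq_iff: "cls u f = cls u g \<longleftrightarrow> f - g \<in> null_hom u u"
proof
  assume "cls u f = cls u g"
  moreover have "f \<in> cls u f"
    by (simp add: mem_cls)
  ultimately show "f - g \<in> null_hom u u"
    by (simp add: mem_cls)
next
  assume fg: "f - g \<in> null_hom u u"
  have "h - f \<in> null_hom u u \<longleftrightarrow> h - g \<in> null_hom u u" for h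
    using null_hom_add[OF _ fg, of "h - f"] null_hom_diff[OF _ fg, of "h - g"] by auto
  then show "cls u f = cls u g"
    by (auto simp: mem_cls)
qed

text \<open>Scalar multiplication and conjugation of classes are defined as unions over all
  representatives; once the value does not depend on the representative, the union
  collapses.\<close>

lemma UN_cls_eq:
  assumes "\<And>g. g \<in> cls u f \<Longrightarrow> F g = F f"
  shows "(\<Union>g\<in>cls u f. F g) = F f"
proof -
  have "f \<in> cls u f"
    by (simp add: mem_cls)
  then show ?thesis
    using assms by blast
qed

lemma ring_free_End: "ring (free_End u :: ('m::nontriv, 'k::field) mor ring)"
proof (rule ringI)
  show "abelian_group (free_End u :: ('m, 'k) mor ring)"
  proof (rule abelian_groupI)
    fix f :: "('m, 'k) mor" assume "f \<in> carrier (free_End u)"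
    then show "\<exists>g\<in>carrier (free_End u). g \<oplus>\<^bsub>free_End u\<^esub> f = \<zero>\<^bsub>free_End u\<^esub>"
      by (intro bexI[of _ "- f"]) (auto simp: free_End_def)
  qed (auto simp: free_End_def algebra_simps)
  show "Group.monoid (free_End u :: ('m, 'k) mor ring)"
    by (rule monoidI) (auto simp: free_End_def vcomp_assoc)
qed (simp_all add: free_End_def vcomp_add_left vcomp_add_right)

lemma ideal_null_hom:
  assumes "(2 :: 'k) \<noteq> 0"
  shows "ideal (null_hom u u) (free_End u :: ('m::nontriv, 'k::field) mor ring)"
proof (rule idealI[OF ring_free_End])
  interpret ring "free_End u :: ('m, 'k) mor ring"
    by (rule ring_free_End)
  have sub: "null_hom u u \<subseteq> (free_hom u u :: ('m, 'k) mor set)"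
    by (rule null_hom_subset_free_hom[OF assms])
  show "subgroup (null_hom u u) (add_monoid (free_End u :: ('m, 'k) mor ring))"
  proof (rule add.subgroupI)
    show "null_hom u u \<noteq> ({} :: ('m, 'k) mor set)"
      using null_hom_zero by blast
    fix f :: "('m, 'k) mor" assume f: "f \<in> null_hom u u"
    have "\<ominus>\<^bsub>free_End u\<^esub> f = - f"
      using f sub by (intro minus_equality) (auto simp: free_End_def)
    then show "\<ominus>\<^bsub>free_End u\<^esub> f \<in> null_hom u u"
      using f by auto
  qed (use sub in \<open>auto simp: free_End_def\<close>)
qed (auto simp: free_End_def null_hom_vcomp_left null_hom_vcomp_right)

lemma one_End: "\<one>\<^bsub>End u\<^esub> = cls u (gr [])"
  by (simp add: End_def ring.defs FactRing_def cls_def free_End_def)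

lemma add_End:
  assumes "(2 :: 'k) \<noteq> 0" "f \<in> free_hom u u" "g \<in> free_hom u u"
  shows "cls u f \<oplus>\<^bsub>End u\<^esub> cls u g = cls u (f + g :: ('m::nontriv, 'k::field) mor)"
proof -
  interpret ideal "null_hom u u" "free_End u :: ('m, 'k) mor ring"
    by (rule ideal_null_hom[OF assms(1)])
  show ?thesis
    using a_rcos_sum[of f g] assms(2,3)
    by (simp add: End_def ring.defs FactRing_def cls_def free_End_def)
qed

lemma mult_End:
  assumes "(2 :: 'k) \<noteq> 0" "f \<in> free_hom u u" "g \<in> free_hom u u"
  shows "cls u f \<otimes>\<^bsub>End u\<^esub> cls u g = cls u (vcomp f g :: ('m::nontriv, 'k::field) mor)"
proof -
  interpret ideal "null_hom u u" "free_End u :: ('m, 'k) mor ring"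
    by (rule ideal_null_hom[OF assms(1)])
  show ?thesis
    using rcoset_mult_add[of f g] assms(2,3)
    by (simp add: End_def ring.defs FactRing_def cls_def free_End_def)
qed

lemma smult_End: "c \<odot>\<^bsub>End u\<^esub> cls u f = cls u (scal c f)"
proof -
  have "c \<odot>\<^bsub>End u\<^esub> cls u f = (\<Union>g\<in>cls u f. cls u (scal c g))"
    by (simp add: End_def ring.defs module.defs cls_def)
  also have "\<dots> = cls u (scal c f)"
    by (rule UN_cls_eq) (auto simp: mem_cls cls_eq_iff simp flip: pm.scale_right_diff_distrib)
  finally show ?thesis .
qed

section \<open>Representatives for elements of the Gelfand--Tsetlin algebra\<close>

lemma broken_soergel_graph: "k < length u \<Longrightarrow> soergel_graph u (broken u k) u"
  by (simp add: broken_def id_take_nth_drop[symmetric])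

lemma JJ_eq_cls: "JJ u k = cls u (gr (broken u k))"
  by (simp add: JJ_def cls_def)

abbreviation GT_carrier :: "'m::nontriv expr \<Rightarrow> ('m, 'k::field) mor set set" where
  "GT_carrier u \<equiv> subalgebra_gen (End u) {JJ u k | k. k < length u}"

lemma GT_carrier_cases:
  assumes two: "(2 :: 'k) \<noteq> 0"
    and "X \<in> (GT_carrier u :: ('m::nontriv, 'k::field) mor set set)"
  obtains f where "f \<in> free_hom u u" "X = cls u f"
proof -
  from assms(2) have "\<exists>f\<in>free_hom u u. X = cls u f"
  proof induction
    case (gen X)
    then obtain k where "k < length u" "X = JJ u k"
      by blast
    then show ?case
      by (intro bexI[of _ "gr (broken u k)"]) (simp_all add: JJ_eq_cls broken_soergel_graph)
  next
    case one
    show ?case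
      by (intro bexI[of _ "gr []"]) (simp_all add: one_End)
  next
    case (add X Y)
    then obtain f g where "f \<in> free_hom u u" "X = cls u f" "g \<in> free_hom u u" "Y = cls u g"
      by blast
    then show ?case
      by (intro bexI[of _ "f + g"]) (auto simp: add_End[OF two])
  next
    case (mult X Y)
    then obtain f g where "f \<in> free_hom u u" "X = cls u f" "g \<in> free_hom u u" "Y = cls u g"
      by blast
    then show ?case
      by (intro bexI[of _ "vcomp f g"]) (auto simp: mult_End[OF two])
  next
    case (smult X c)
    then obtain f where "f \<in> free_hom u u" "X = cls u f"
      by blast
    then show ?case
      by (intro bexI[of _ "scal c f"]) (auto simp: smult_End)
  qed
  then show ?thesis
    using that by blast
qed


section \<open>Conjugation by an invertible graph\<close>

text \<open>Symmetric under exchanging \<open>u\<close> with \<open>v\<close> and \<alpha> with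
  \<beta>, so a second instance supplies the inverse map. Lists run from bottom to top: in
  \<open>\<beta> @ broken u k @ \<alpha>\<close> the graph \<beta> is at the bottom.\<close>

locale conjugation =
  fixes u v :: "'m::nontriv expr" and \<alpha> \<beta> :: "('m, 'k::field) graph"
  assumes two: "(2 :: 'k) \<noteq> 0"
    and graph_\<alpha>: "soergel_graph u \<alpha> v"
    and graph_\<beta>: "soergel_graph v \<beta> u"
    and \<alpha>_\<beta>: "graph_eq u u (\<alpha> @ \<beta>) []"
    and \<beta>_\<alpha>: "graph_eq v v (\<beta> @ \<alpha>) []"
    and conj_broken: "k < length u \<Longrightarrow>
      \<exists>k'<length v. graph_eq v v (\<beta> @ broken u k @ \<alpha>) (broken v k')"
begin

definition conj_mor :: "('m, 'k) mor \<Rightarrow> ('m, 'k) mor" where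
  "conj_mor f = vcomp (gr \<alpha>) (vcomp f (gr \<beta>))"

definition conj_cls :: "('m, 'k) mor set \<Rightarrow> ('m, 'k) mor set" where
  "conj_cls X = (\<Union>f\<in>X. cls v (conj_mor f))"

lemma gr_free_hom: "gr \<alpha> \<in> free_hom u v" "gr \<beta> \<in> free_hom v u"
  using graph_\<alpha> graph_\<beta> by simp_all

lemma conj_mor_free_hom: "f \<in> free_hom u u \<Longrightarrow> conj_mor f \<in> free_hom v v"
  unfolding conj_mor_def using gr_free_hom by blast

lemma conj_mor_add: "conj_mor (f + g) = conj_mor f + conj_mor g"
  by (simp add: conj_mor_def vcomp_add_left vcomp_add_right)

lemma conj_mor_scal: "conj_mor (scal c f) = scal c (conj_mor f)"
  by (simp add: conj_mor_def vcomp_scal_left vcomp_scal_right)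

lemma conj_cls_cls: "conj_cls (cls u f) = cls v (conj_mor f)"
  unfolding conj_cls_def
proof (rule UN_cls_eq)
  fix g assume "g \<in> cls u f"
  then have "vcomp (gr \<alpha>) (vcomp (g - f) (gr \<beta>)) \<in> null_hom v v"
    unfolding mem_cls
    by (intro null_hom_vcomp_left[of _ u v] null_hom_vcomp_right[of _ u u] gr_free_hom)
  then show "cls v (conj_mor g) = cls v (conj_mor f)"
    by (simp add: cls_eq_iff conj_mor_def vcomp_diff_left vcomp_diff_right)
qed

lemma cls_conj_mor_mult:
  assumes "f \<in> free_hom u u" "g \<in> free_hom u u"
  shows "cls v (conj_mor (vcomp f g)) = cls v (vcomp (conj_mor f) (conj_mor g))"
proof -
  have "gr (\<alpha> @ \<beta>) - gr [] \<in> (null_hom u u :: ('m, 'k) mor set)"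
    by (rule graph_eq_null_hom[OF \<alpha>_\<beta>])
  \<comment> \<open>The product of the two conjugates contains \<open>\<alpha> @ \<beta>\<close>
    between \<open>f\<close> and \<open>g\<close>, where the conjugate of the product has the
    identity. This null morphism is their difference.\<close>
  then have "vcomp (gr \<alpha>) (vcomp f (vcomp (gr (\<alpha> @ \<beta>) - gr []) (vcomp g (gr \<beta>)))) \<in> null_hom v v"
    using assms gr_free_hom
    by (intro null_hom_vcomp_left[of _ u v] null_hom_vcomp_left[of _ u u]
        null_hom_vcomp_right[of _ u u]) auto
  \<comment> \<open>The order is reversed because \<open>vcomp\<close> names the upper factor first.
    The composite is kept unevaluated afterwards so that \<open>vcomp_assoc\<close> can regroup its
    factors.\<close>
  moreover have "gr (\<alpha> @ \<beta>) = vcomp (gr \<beta>) (gr \<alpha>)"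
    by simp
  ultimately have "vcomp (conj_mor f) (conj_mor g) - conj_mor (vcomp f g) \<in> null_hom v v"
    by (simp add: conj_mor_def vcomp_diff_left vcomp_diff_right vcomp_assoc del: vcomp_single)
  then show ?thesis
    unfolding cls_eq_iff[symmetric] by simp
qed

lemma conj_cls_one: "conj_cls (cls u (gr [])) = cls v (gr [])"
  unfolding conj_cls_cls using graph_eq_null_hom[OF \<beta>_\<alpha>]
  by (simp add: conj_mor_def cls_eq_iff)

lemma conj_cls_add:
  assumes "X \<in> GT_carrier u" "Y \<in> GT_carrier u"
  shows "conj_cls (X \<oplus>\<^bsub>End u\<^esub> Y) = conj_cls X \<oplus>\<^bsub>End v\<^esub> conj_cls Y"
  using assms
  by (elim GT_carrier_cases[OF two])
    (simp add: add_End two conj_cls_cls conj_mor_add conj_mor_free_hom)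

lemma conj_cls_mult:
  assumes "X \<in> GT_carrier u" "Y \<in> GT_carrier u"
  shows "conj_cls (X \<otimes>\<^bsub>End u\<^esub> Y) = conj_cls X \<otimes>\<^bsub>End v\<^esub> conj_cls Y"
  using assms
  by (elim GT_carrier_cases[OF two])
    (simp add: mult_End two conj_cls_cls cls_conj_mor_mult conj_mor_free_hom)

lemma conj_cls_smult:
  assumes "X \<in> GT_carrier u"
  shows "conj_cls (c \<odot>\<^bsub>End u\<^esub> X) = c \<odot>\<^bsub>End v\<^esub> conj_cls X"
  using assms
  by (elim GT_carrier_cases[OF two]) (simp add: smult_End conj_cls_cls conj_mor_scal)

lemma conj_cls_GT_carrier: "X \<in> GT_carrier u \<Longrightarrow> conj_cls X \<in> GT_carrier v"
proof (induction rule: subalgebra_gen.induct)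
  case (gen X)
  then obtain k where k: "k < length u" and X: "X = JJ u k"
    by blast
  obtain k' where "k' < length v" and eq: "graph_eq v v (\<beta> @ broken u k @ \<alpha>) (broken v k')"
    using conj_broken[OF k] by blast
  moreover have "conj_cls X = JJ v k'"
    using graph_eq_null_hom[OF eq] by (simp add: X JJ_eq_cls conj_cls_cls cls_eq_iff conj_mor_def)
  ultimately show ?case
    by (intro subalgebra_gen.gen) blast
next
  case one
  show ?case
    using subalgebra_gen.one[of "End v"] by (simp add: one_End conj_cls_one)
next
  case (add X Y)
  then show ?case
    by (simp add: conj_cls_add subalgebra_gen.add)
next
  case (mult X Y)
  then show ?case
    by (simp add: conj_cls_mult subalgebra_gen.mult)
next
  case (smult X c)
  then show ?case
    by (simp add: conj_cls_smult subalgebra_gen.smult)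
qed

end

lemma conj_cls_inverse:
  fixes u v :: "'m::nontriv expr" and \<alpha> \<beta> :: "('m, 'k::field) graph"
  assumes "conjugation u v \<alpha> \<beta>" "conjugation v u \<beta> \<alpha>"
    and X: "X \<in> GT_carrier u"
  shows "conjugation.conj_cls u \<beta> \<alpha> (conjugation.conj_cls v \<alpha> \<beta> X) = X"
proof -
  interpret c: conjugation u v \<alpha> \<beta> by fact
  interpret d: conjugation v u \<beta> \<alpha> by fact
  from X obtain f where f: "f \<in> free_hom u u" and X: "X = cls u f"
    by (rule GT_carrier_cases[OF c.two])
  have n: "gr (\<alpha> @ \<beta>) - gr [] \<in> (null_hom u u :: ('m, 'k) mor set)"
    by (rule graph_eq_null_hom[OF c.\<alpha>_\<beta>])
  have ab: "gr (\<alpha> @ \<beta>) \<in> (free_hom u u :: ('m, 'k) mor set)"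
    using c.graph_\<alpha> c.graph_\<beta> by (auto simp: soergel_graph_append)
  \<comment> \<open>With E for the class of \<open>\<alpha> @ \<beta>\<close>, the telescoping E f E
    - f = E f (E - 1) + (E - 1) f puts a null factor in each summand.\<close>
  have "vcomp (gr (\<alpha> @ \<beta>)) (vcomp f (gr (\<alpha> @ \<beta>) - gr [])) + vcomp (gr (\<alpha> @ \<beta>) - gr []) f \<in> null_hom u u"
    using n ab f by (intro null_hom_add null_hom_vcomp_left[of _ u u] null_hom_vcomp_right[of _ u u])
  moreover have "gr (\<alpha> @ \<beta>) = vcomp (gr \<beta>) (gr \<alpha>)"
    by simp
  ultimately have "d.conj_mor (c.conj_mor f) - f \<in> null_hom u u"
    by (simp add: c.conj_mor_def d.conj_mor_def vcomp_diff_left vcomp_diff_right vcomp_assoc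
        del: vcomp_single)
  then show ?thesis
    by (simp add: X c.conj_cls_cls d.conj_cls_cls cls_eq_iff)
qed

text \<open>Bijectivity comes from the opposite conjugation as two-sided inverse, so surjectivity
  onto the generators need not be traced through the subalgebra.\<close>

lemma alg_isomorphic_GT:
  fixes u v :: "'m::nontriv expr" and \<alpha> \<beta> :: "('m, 'k::field) graph"
  assumes "conjugation u v \<alpha> \<beta>" "conjugation v u \<beta> \<alpha>"
  shows "alg_isomorphic (GT u :: ('k, ('m, 'k) mor set) module) (GT v)"
proof -
  interpret c: conjugation u v \<alpha> \<beta> by fact
  interpret d: conjugation v u \<beta> \<alpha> by fact
  have "bij_betw c.conj_cls (GT_carrier u) (GT_carrier v)"
    using conj_cls_inverse[OF assms] conj_cls_inverse[OF assms(2,1)]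
      c.conj_cls_GT_carrier d.conj_cls_GT_carrier
    by (intro bij_betw_byWitness[where f' = d.conj_cls]) auto
  then have "c.conj_cls \<in> alg_iso (GT u) (GT v)"
    by (auto simp: alg_iso_def ring_iso_def GT_def c.conj_cls_GT_carrier c.conj_cls_add
        c.conj_cls_mult c.conj_cls_smult one_End c.conj_cls_one intro!: ring_hom_memI)
  then show ?thesis
    by (auto simp: alg_isomorphic_def)
qed

lemma conjugation_crossing:
  fixes b c :: "'m::nontriv mod_ring"
  assumes "(2 :: 'k::field) \<noteq> 0" and bc: "cox b c = 2"
  shows "conjugation (x @ [b, c] @ y) (x @ [c, b] @ y)
    [(x, Vertex b c, y) :: ('m, 'k) layer] [(x, Vertex c b, y)]"
proof
  note [simp] = cox_simps[OF bc] alt_2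
  show "graph_eq (x @ [b, c] @ y) (x @ [b, c] @ y)
      ([(x, Vertex b c, y) :: ('m, 'k) layer] @ [(x, Vertex c b, y)]) []"
    using graph_eq_in_context[OF crossing_crossing[OF bc],
        of "x @ [b, c] @ y" "[]" x y "[]" "x @ [b, c] @ y"] by simp
  show "graph_eq (x @ [c, b] @ y) (x @ [c, b] @ y)
      ([(x, Vertex c b, y) :: ('m, 'k) layer] @ [(x, Vertex b c, y)]) []"
    using graph_eq_in_context[OF crossing_crossing[of c b],
        of "x @ [c, b] @ y" "[]" x y "[]" "x @ [c, b] @ y"] by simp
qed (use assms conj_broken[OF bc] cox_simps[OF bc] in \<open>simp_all add: alt_2\<close>)

theorem theorem3p19:
  fixes b c :: "'m::nontriv mod_ring"
    and x y u v :: "'m expr"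
  assumes "CHAR('k::field) \<noteq> 2"
    and "c \<noteq> b" and "c \<noteq> b + 1" and "c \<noteq> b - 1"
    and "u = x @ [b, c] @ y"
    and "v = x @ [c, b] @ y"
  shows "alg_isomorphic (GT u :: ('k, ('m, 'k) mor set) module) (GT v)"
proof -
  \<comment> \<open>The indices \<open>b\<close>, \<open>b + 1\<close> and \<open>c\<close> are
    distinct, which excludes the rank with infinite Coxeter entry.\<close>
  have "CARD('m) \<noteq> 2"
  proof
    assume m: "CARD('m) = 2"
    then have "card {b, b + 1, c} \<le> 2"
      using card_mono[of "UNIV :: 'm mod_ring set" "{b, b + 1, c}"] by simp
    moreover have "card {b, b + 1, c} = 3"
      using assms(2,3) by simp
    ultimately show False
      by simp
  qed
  then have "cox b c = 2" "cox c b = 2"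
    using assms(2-4) by (auto simp: cox_def algebra_simps)
  moreover have "(2 :: 'k) \<noteq> 0"
  proof
    assume "(2 :: 'k) = 0"
    \<comment> \<open>A characteristic dividing 2 is 1 or 2, and a field does not have
      characteristic 1.\<close>
    then have dvd: "CHAR('k) dvd 2"
      using of_nat_eq_0_iff_char_dvd[where 'a = 'k, of 2] by simp
    then have "CHAR('k) \<noteq> 0"
      by (metis dvd_0_left_iff zero_neq_numeral)
    then show False
      using assms(1) CHAR_not_1[where 'a = 'k] dvd_imp_le[OF dvd] by linarith
  qed
  ultimately show ?thesis
    unfolding assms(5,6)
    by (intro alg_isomorphic_GT[OF conjugation_crossing conjugation_crossing])
qed

end
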